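(* Let $p > 3$ be a prime, fix $\lambda \in \mathbb{F}_p^{\times}$, and let $\phi$ be the quadratic character of $\mathbb{F}_p$. Then $$(1)\quad H_{p}\left(\left\{\tfrac12,\tfrac14,\tfrac34\right\},\left\{1,\tfrac13,\tfrac23\right\};\lambda\right) = \phi(-3 \lambda) \sum_{a \in A_{\lambda,p}} \phi(a),$$ where $A_{\lambda,p} = \{a \in \mathbb{F}_p \setminus \{0,1\} : 27 \lambda(a^{3}-a^{2}) + 4 = 0 \}$; $$(2)\quad H_{p}\left(\left\{\tfrac12,\tfrac16,\tfrac56\right\},\left\{1,\tfrac14,\tfrac34\right\};\lambda\right) = \sum_{a \in B_{\lambda,p}} \phi(a^{2}-a) - \phi\left(-\frac{\lambda}{3}\right),$$ where $B_{\lambda,p} = \{a \in \mathbb{F}_p \setminus \{0,1\} : 256\lambda(a^{4}-a^{3}) + 27 = 0 \}$; $$(3)\quad H_{p}\left(\left\{\tfrac12,\tfrac16,\tfrac56\right\},\left\{1,\tfrac13,\tfrac23\right\};\lambda\right) = \sum_{a \in C_{\lambda,p}} \phi(a),$$ where $C_{\lambda,p} = \{a \in \mathbb{F}_p \setminus \{0,1\} : (\lambda-1)a^{3} + 3a^{2}-3a+1=0 \}$.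
   Context: Finite hypergeometric function. Let $p$ be an odd prime, $\zeta_p$ a fixed primitive $p$th root of unity, $\omega$ a generator of the group of multiplicative characters $\widehat{\mathbb{F}_p^\times}$, with the convention $\chi(0)=0$ for every multiplicative character $\chi$. The Gauss sum is $g(\chi)=\sum_{x\in\mathbb{F}_p^\times}\chi(x)\zeta_p^{x}$. Let $\alpha=\{a_1,\dots,a_n\}$, $\beta=\{1,b_2,\dots,b_n\}$ (put $b_1=1$) be multisets of rationals such that $a_i-b_j\notin\mathbb{Z}$ for all $i,j$ and such that $\prod_j(X-e^{2\pi i a_j})$ and $\prod_j(X-e^{2\pi i b_j})$ lie in $\mathbb{Z}[X]$. Let $M$ be the least positive common denominator of the elements of $\alpha\cup\beta$, and suppose $p\nmid M$. If $p\equiv 1\pmod M$, then for $\lambda\in\mathbb{F}_p^\times$ $$H_p(\alpha,\beta;\lambda)=\frac{1}{1-p}\sum_{k=0}^{p-2}\prod_{i=1}^n\frac{g(\omega^{k+(p-1)a_i})\,g(\omega^{-k-(p-1)b_i})}{g(\omega^{(p-1)a_i})\,g(\omega^{-(p-1)b_i})}\,\omega^k((-1)^n\lambda).$$ For all odd primes $p\nmid M$ the function is defined by the following extension (Beukers–Cohen–Mellit), which agrees with the formula above when $p\equiv1\pmod M$. Write $$\prod_{j=1}^n\frac{X-e^{2\pi i a_j}}{X-e^{2\pi i b_j}}=\frac{\prod_{i=1}^r(X^{u_i}-1)}{\prod_{j=1}^t(X^{v_j}-1)}$$ with positive integers $u_i,v_j$ satisfying $u_i\ne v_j$ for all $i,j$;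 let $D(X)$ be the gcd of $\prod_i(X^{u_i}-1)$ and $\prod_j(X^{v_j}-1)$, let $s(k)$ be the multiplicity of $e^{2\pi i k/(p-1)}$ as a zero of $D$, and let $N=\prod_i u_i^{u_i}/\prod_j v_j^{v_j}$. Then $$H_p(\alpha,\beta;\lambda)=\frac{(-1)^{r+t}}{1-p}\sum_{k=0}^{p-2}p^{-s(0)+s(k)}\prod_{i=1}^r g(\omega^{u_ik})\prod_{j=1}^t g(\omega^{-v_jk})\;\omega^k\!\left((-1)^{v_1+\cdots+v_t}N^{-1}\lambda\right).$$ *)

theory Defs
  imports
    Complex_Main
    "HOL-Library.Multiset"
    "HOL-Computational_Algebra.Computational_Algebra"
    "HOL-Computational_Algebra.Field_as_Ring"
    "HOL-Number_Theory.Quadratic_Reciprocity"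
    "Berlekamp_Zassenhaus.Finite_Field"
begin

text \<open>The prime field with \<open>p\<close> elements is the type \<open>'p mod_ring\<close> with \<open>'p::prime_card\<close> and
  \<open>p = CARD('p)\<close>.\<close>

definition mult_char :: "('p::prime_card mod_ring \<Rightarrow> complex) \<Rightarrow> bool" where
  "mult_char \<psi> \<longleftrightarrow> \<psi> 0 = 0 \<and> \<psi> 1 = 1 \<and> (\<forall>x y. \<psi> (x * y) = \<psi> x * \<psi> y)"

text \<open>The case distinction keeps the value at \<open>0\<close> equal to \<open>0\<close> for the trivial character too,
  where \<open>0 powi 0 = 1\<close> would interfere.\<close>

definition char_powi :: "('p::prime_card mod_ring \<Rightarrow> complex) \<Rightarrow> int \<Rightarrow> 'p mod_ring \<Rightarrow> complex" where
  "char_powi \<psi> k = (\<lambda>x. if x = 0 then 0 else \<psi> x powi k)"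

definition generates_chars :: "('p::prime_card mod_ring \<Rightarrow> complex) \<Rightarrow> bool" where
  "generates_chars \<omega> \<longleftrightarrow>
     mult_char \<omega> \<and> (\<forall>\<psi>. mult_char \<psi> \<longrightarrow> (\<exists>k. \<psi> = char_powi \<omega> k))"

definition primitive_root_of_unity :: "nat \<Rightarrow> complex \<Rightarrow> bool" where
  "primitive_root_of_unity n z \<longleftrightarrow> z ^ n = 1 \<and> (\<forall>k. 0 < k \<and> k < n \<longrightarrow> z ^ k \<noteq> 1)"

definition quad_char :: "'p::prime_card mod_ring \<Rightarrow> complex" where
  "quad_char x = of_int (Legendre (to_int_mod_ring x) (int CARD('p)))"

definition gauss_sum :: "complex \<Rightarrow> ('p::prime_card mod_ring \<Rightarrow> complex) \<Rightarrow> complex" where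
  "gauss_sum \<zeta> \<psi> = (\<Sum>x\<in>UNIV - {0}. \<psi> x * \<zeta> powi to_int_mod_ring x)"

definition root_poly :: "rat multiset \<Rightarrow> complex poly" where
  "root_poly \<alpha> = (\<Prod>a\<in>#\<alpha>. [:- cis (2 * pi * of_rat a), 1:])"

definition cyc_poly :: "nat multiset \<Rightarrow> complex poly" where
  "cyc_poly us = (\<Prod>u\<in>#us. Polynomial.monom 1 u - 1)"

definition cyc_data :: "rat multiset \<Rightarrow> rat multiset \<Rightarrow> nat multiset \<Rightarrow> nat multiset \<Rightarrow> bool" where
  "cyc_data \<alpha> \<beta> us vs \<longleftrightarrow>
     (\<forall>u\<in>#us. 0 < u) \<and> (\<forall>v\<in>#vs. 0 < v) \<and> (\<forall>u\<in>#us. \<forall>v\<in>#vs. u \<noteq> v) \<and>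
     Fraction_Field.Fract (root_poly \<alpha>) (root_poly \<beta>) = Fraction_Field.Fract (cyc_poly us) (cyc_poly vs)"

definition zero_mult :: "nat \<Rightarrow> nat multiset \<Rightarrow> nat multiset \<Rightarrow> nat \<Rightarrow> nat" where
  "zero_mult p us vs k =
     Polynomial.order (cis (2 * pi * real k / real (p - 1))) (gcd (cyc_poly us) (cyc_poly vs))"

text \<open>The Beukers--Cohen--Mellit sum. The rational number \<open>N\<close> enters only through its residue
  class, so it is formed directly in the field; it is a unit there when \<open>p\<close> divides none of the
  \<open>u\<close> and \<open>v\<close>.\<close>

definition BCM_sum ::
  "('p::prime_card mod_ring \<Rightarrow> complex) \<Rightarrow> complex \<Rightarrow> nat multiset \<Rightarrow> nat multiset \<Rightarrow> 'p mod_ring \<Rightarrow> complex"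
where
  "BCM_sum \<omega> \<zeta> us vs x =
     (let p = CARD('p);
          N = (\<Prod>u\<in>#us. of_nat u ^ u) / (\<Prod>v\<in>#vs. of_nat v ^ v) :: 'p mod_ring
      in (- 1) ^ (size us + size vs) / (1 - of_nat p) *
         (\<Sum>k=0..p-2.
            of_nat p powi (- int (zero_mult p us vs 0) + int (zero_mult p us vs k)) *
            (\<Prod>u\<in>#us. gauss_sum \<zeta> (char_powi \<omega> (int (u * k)))) *
            (\<Prod>v\<in>#vs. gauss_sum \<zeta> (char_powi \<omega> (- int (v * k)))) *
            char_powi \<omega> (int k) ((- 1) ^ (\<Sum>\<^sub># vs) * inverse N * x)))"

text \<open>The finite hypergeometric function. It is meaningful when \<open>p\<close> is odd and prime to the
  denominators of \<open>\<alpha>\<close> and \<open>\<beta>\<close>, no \<open>a - b\<close> is an integer, and both root polynomials have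
  integer coefficients; the pair \<open>(us, vs)\<close> then exists and is unique, because the polynomials
  \<open>X^u - 1\<close> are multiplicatively independent.\<close>

definition hyp_H ::
  "('p::prime_card mod_ring \<Rightarrow> complex) \<Rightarrow> complex \<Rightarrow> rat multiset \<Rightarrow> rat multiset \<Rightarrow> 'p mod_ring \<Rightarrow> complex"
where
  "hyp_H \<omega> \<zeta> \<alpha> \<beta> x =
     (THE h. \<exists>us vs. cyc_data \<alpha> \<beta> us vs \<and> h = BCM_sum \<omega> \<zeta> us vs x)"

end

theory Submission
  imports Defs "HOL-Number_Theory.Residue_Primitive_Roots"
begin

text \<open>The pair of cyclotomic exponent multisets is determined by the roots, because the order of
  vanishing at a primitive \<open>m\<close>-th root of unity counts the exponents divisible by \<open>m\<close>. Thus the three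
  functions are the Beukers--Cohen--Mellit sums with exponents \<open>(4; 1, 3)\<close>, \<open>(6, 2; 3, 1, 4)\<close> and
  \<open>(6; 3, 3)\<close>. The Hasse--Davenport duplication formula and the reflection formula for Gauss sums
  absorb the weights \<open>p powi (s(k) - s(0))\<close> and leave, for each \<open>k\<close>, a product of Gauss sums of characters
  with product \<open>1\<close> (or \<open>\<phi>\<close>), that is, a Jacobi sum; summing over \<open>k\<close> with orthogonality of characters turns the
  latter into a sum over the roots of a trinomial. For \<open>(4; 1, 3)\<close> this also works without duplication
  and gives the number of roots of a quartic minus \<open>1\<close>; comparing both evaluations at \<open>1/\<lambda>\<close> converts
  the cubic obtained for \<open>(6, 2; 3, 1, 4)\<close> into the quartic of part (2).\<close>

section \<open>Cyclotomic exponents\<close>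

lemma order_gcd_poly:
  fixes P Q :: "complex poly"
  assumes "P \<noteq> 0" "Q \<noteq> 0"
  shows "Polynomial.order z (gcd P Q) = min (Polynomial.order z P) (Polynomial.order z Q)"
proof (rule antisym)
  have "[:-z, 1:] ^ min (Polynomial.order z P) (Polynomial.order z Q) dvd gcd P Q"
    by (rule gcd_greatest) (auto simp: order_divides)
  then show "min (Polynomial.order z P) (Polynomial.order z Q) \<le> Polynomial.order z (gcd P Q)"
    using assms by (simp only: order_divides gcd_eq_0_iff) simp
qed (use assms in \<open>simp add: dvd_imp_order_le\<close>)

lemma monom_minus_one_nonzero:
  assumes "0 < u"
  shows "Polynomial.monom 1 u - 1 \<noteq> (0 :: complex poly)"
proof
  assume "Polynomial.monom 1 u - 1 = (0 :: complex poly)"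
  then have "poly (Polynomial.monom 1 u - 1) 0 = (0 :: complex)" by simp
  with assms show False by (simp add: poly_monom power_0_left)
qed

text \<open>In characteristic zero the derivative has no zero other than possibly \<open>0\<close>,
  which is not a root, so every root is simple.\<close>

lemma order_monom_minus_one:
  fixes z :: complex
  assumes "0 < u"
  shows "Polynomial.order z (Polynomial.monom 1 u - 1) = of_bool (z ^ u = 1)"
proof (cases "z ^ u = 1")
  case True
  let ?P = "Polynomial.monom 1 u - 1 :: complex poly"
  have z: "z \<noteq> 0" using True assms by (metis power_0_left zero_neq_one less_numeral_extra(3))
  have D: "pderiv ?P = Polynomial.monom (of_nat u) (u - 1)"
    by (simp add: pderiv_diff pderiv_monom)
  have "Polynomial.order z ?P = Suc (Polynomial.order z (pderiv ?P))"
    using monom_minus_one_nonzero[OF assms] by (rule order_pderiv) (simp add: poly_monom True)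
  moreover have "Polynomial.order z (pderiv ?P) = 0"
    using z assms by (intro order_0I) (simp add: D poly_monom)
  ultimately show ?thesis using True by simp
next
  case False
  then show ?thesis by (simp add: order_0I poly_monom)
qed

lemma cyc_poly_nonzero:
  assumes "\<forall>u\<in>#us. 0 < u"
  shows "cyc_poly us \<noteq> 0"
  using assms
proof (induction us)
  case (add u us)
  then show ?case using monom_minus_one_nonzero[of u] by (simp add: cyc_poly_def del: right_minus_eq)
qed (simp add: cyc_poly_def)

lemma order_cyc_poly:
  assumes "\<forall>u\<in>#us. 0 < u"
  shows "Polynomial.order z (cyc_poly us) = size (filter_mset (\<lambda>u. z ^ u = 1) us)"
  using assms
proof (induction us)
  case empty
  then show ?case by (simp add: cyc_poly_def)
next
  case (add u us)
  have eq: "cyc_poly (add_mset u us) = (Polynomial.monom 1 u - 1) * cyc_poly us"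
    by (simp add: cyc_poly_def)
  have "(Polynomial.monom 1 u - 1) * cyc_poly us \<noteq> 0"
    using add.prems cyc_poly_nonzero[of us] monom_minus_one_nonzero[of u] by auto
  then show ?case
    using add by (simp add: eq order_mult order_monom_minus_one)
qed

text \<open>Serves twice: \<open>k = 1\<close> gives a primitive \<open>m\<close>-th root of unity,
  and \<open>m = p - 1\<close> gives the points at which \<open>zero_mult\<close> measures the
  order.\<close>

lemma cis_root_power_eq_1_iff:
  assumes "0 < m"
  shows "cis (2 * pi * real k / real m) ^ u = 1 \<longleftrightarrow> m dvd u * k"
proof -
  have "cis (2 * pi * real k / real m) ^ u = cis (2 * pi * (real (u * k) / real m))"
    by (simp add: DeMoivre algebra_simps)
  also have "\<dots> = 1 \<longleftrightarrow> (\<exists>i. real (u * k) / real m = of_int i)"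
  proof -
    have "cis (2 * pi * (real (u * k) / real m)) = 1 \<longleftrightarrow> cos (2 * pi * (real (u * k) / real m)) = 1"
      by (auto simp: complex_eq_iff cos_one_sin_zero)
    also have "\<dots> \<longleftrightarrow> (\<exists>i::int. real (u * k) / real m = of_int i)"
    proof -
      have "2 * pi * t = of_int i * 2 * pi \<longleftrightarrow> t = of_int i" for t and i :: int
        by auto
      then show ?thesis unfolding cos_one_2pi_int by blast
    qed
    finally show ?thesis .
  qed
  also have "\<dots> \<longleftrightarrow> (\<exists>i. int (u * k) = int m * i)"
  proof -
    have "real (u * k) / real m = of_int i \<longleftrightarrow> int (u * k) = int m * i" for i :: int
    proof -
      have "real (u * k) / real m = of_int i \<longleftrightarrow> of_int (int (u * k)) = (of_int (int m * i) :: real)"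
        using assms by (simp add: field_simps)
      then show ?thesis by (simp only: of_int_eq_iff)
    qed
    then show ?thesis by simp
  qed
  also have "\<dots> \<longleftrightarrow> m dvd u * k" by (metis dvd_def int_dvd_int_iff)
  finally show ?thesis .
qed

text \<open>At the largest \<open>n\<close> whose counts differ, all other multiples of
  \<open>n\<close> are larger and occur equally often, so the numbers of multiples of
  \<open>n\<close> would differ as well. Positivity excludes \<open>0\<close>, a multiple of
  \<open>n\<close> that is not larger.\<close>

lemma mset_eqI_count_multiples:
  fixes A B :: "nat multiset"
  assumes pos: "\<forall>a\<in>#A. 0 < a" "\<forall>b\<in>#B. 0 < b"
    and eq: "\<And>m. 0 < m \<Longrightarrow> size (filter_mset ((dvd) m) A) = size (filter_mset ((dvd) m) B)"
  shows "A = B"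
proof (rule ccontr)
  assume "A \<noteq> B"
  define S where "S = {n. count A n \<noteq> count B n}"
  have "S \<subseteq> set_mset A \<union> set_mset B" by (auto simp: S_def not_in_iff)
  then have fin: "finite S" by (rule finite_subset) simp
  from \<open>A \<noteq> B\<close> have "S \<noteq> {}" by (auto simp: S_def multiset_eq_iff)
  define n where "n = Max S"
  have nS: "n \<in> S" using fin \<open>S \<noteq> {}\<close> by (simp add: n_def)
  have n0: "0 < n" using nS \<open>S \<subseteq> _\<close> pos by auto
  have above: "count A k = count B k" if "n < k" for k
    using that Max_ge[OF fin, of k] by (auto simp: n_def S_def)
  have "filter_mset (\<lambda>a. n dvd a \<and> a \<noteq> n) A = filter_mset (\<lambda>a. n dvd a \<and> a \<noteq> n) B"
  proof (rule multiset_eqI)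
    fix k
    show "count (filter_mset (\<lambda>a. n dvd a \<and> a \<noteq> n) A) k = count (filter_mset (\<lambda>a. n dvd a \<and> a \<noteq> n) B) k"
      using above[of k] pos by (cases "k = 0") (auto simp: not_in_iff dest: dvd_imp_le, metis not_in_iff less_irrefl)
  qed
  moreover have "size (filter_mset ((dvd) n) M) = count M n + size (filter_mset (\<lambda>a. n dvd a \<and> a \<noteq> n) M)" for M
    by (induction M) auto
  ultimately have "count A n = count B n" using eq[OF n0] by simp
  with nS show False by (simp add: S_def)
qed

lemma cyc_poly_inject:
  assumes pos: "\<forall>u\<in>#us. 0 < u" "\<forall>v\<in>#vs. 0 < v" and eq: "cyc_poly us = cyc_poly vs"
  shows "us = vs"
proof (rule mset_eqI_count_multiples[OF pos])
  fix m :: nat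
  assume m: "0 < m"
  have "size (filter_mset ((dvd) m) ws) = Polynomial.order (cis (2 * pi * real 1 / real m)) (cyc_poly ws)"
    if "\<forall>w\<in>#ws. 0 < w" for ws
    unfolding order_cyc_poly[OF that] cis_root_power_eq_1_iff[OF m] by simp
  with pos eq show "size (filter_mset ((dvd) m) us) = size (filter_mset ((dvd) m) vs)" by simp
qed

text \<open>Cross-multiplication and \<open>cyc_poly_inject\<close> give
  \<open>us + vs' = us' + vs\<close>; disjointness of numerator and denominator exponents then
  separates the two sides.\<close>

lemma cyc_data_unique:
  assumes "cyc_data \<alpha> \<beta> us vs" "cyc_data \<alpha> \<beta> us' vs'"
  shows "us' = us \<and> vs' = vs"
proof -
  have pos: "\<forall>u\<in>#us. 0 < u" "\<forall>v\<in>#vs. 0 < v" "\<forall>u\<in>#us'. 0 < u" "\<forall>v\<in>#vs'. 0 < v"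
    and disj: "set_mset us \<inter> set_mset vs = {}" "set_mset us' \<inter> set_mset vs' = {}"
    and "Fract (cyc_poly us) (cyc_poly vs) = Fract (cyc_poly us') (cyc_poly vs')"
    using assms by (auto simp: cyc_data_def)
  then have "cyc_poly us * cyc_poly vs' = cyc_poly us' * cyc_poly vs"
    by (simp add: eq_fract cyc_poly_nonzero)
  then have "cyc_poly (us + vs') = cyc_poly (us' + vs)"
    by (simp add: cyc_poly_def)
  then have sum: "us + vs' = us' + vs"
    by (intro cyc_poly_inject) (use pos in auto)
  have "count us' n = count us n \<and> count vs' n = count vs n" for n
  proof -
    have "count us n + count vs' n = count us' n + count vs n"
      using arg_cong[OF sum, of "\<lambda>M. count M n"] by simp
    moreover have "count us n = 0 \<or> count vs n = 0" "count us' n = 0 \<or> count vs' n = 0"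
      using disj by (auto simp: count_eq_zero_iff)
    ultimately show ?thesis by linarith
  qed
  then show ?thesis by (auto intro: multiset_eqI)
qed

text \<open>By uniqueness, exhibiting a single pair of exponent multisets evaluates the definite
  description.\<close>

lemma hyp_H_eqI:
  assumes "cyc_data \<alpha> \<beta> us vs"
  shows "hyp_H \<omega> \<zeta> \<alpha> \<beta> x = BCM_sum \<omega> \<zeta> us vs x"
  unfolding hyp_H_def
proof (rule the_equality)
  fix h
  assume "\<exists>us vs. cyc_data \<alpha> \<beta> us vs \<and> h = BCM_sum \<omega> \<zeta> us vs x"
  then obtain us' vs' where "cyc_data \<alpha> \<beta> us' vs'" "h = BCM_sum \<omega> \<zeta> us' vs' x" by blast
  with cyc_data_unique[OF assms] show "h = BCM_sum \<omega> \<zeta> us vs x" by metis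
qed (use assms in blast)

text \<open>The order in a gcd is the smaller of the two orders, and each of these counts the
  exponents that send the root of unity to \<open>1\<close>.\<close>

lemma zero_mult_eq:
  assumes us: "\<forall>u\<in>#us. 0 < u" and vs: "\<forall>v\<in>#vs. 0 < v" and p: "1 < p"
  shows "zero_mult p us vs k =
    min (size (filter_mset (\<lambda>u. p - 1 dvd u * k) us)) (size (filter_mset (\<lambda>v. p - 1 dvd v * k) vs))"
proof -
  have "0 < p - 1" using p by simp
  then show ?thesis
    unfolding zero_mult_def order_gcd_poly[OF cyc_poly_nonzero[OF us] cyc_poly_nonzero[OF vs]]
      order_cyc_poly[OF us] order_cyc_poly[OF vs] by (subst (1 2) cis_root_power_eq_1_iff) auto
qed

section \<open>The exponents of the three parameter pairs\<close>

lemma cis_values: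
  "cis (2 * pi * of_rat 1) = 1" "cis (2 * pi * of_rat (1/2)) = -1"
  "cis (2 * pi * of_rat (1/4)) = \<i>" "cis (2 * pi * of_rat (3/4)) = - \<i>"
  "cis (2 * pi * of_rat (1/3)) = Complex (-1/2) (sqrt 3 / 2)"
  "cis (2 * pi * of_rat (2/3)) = Complex (-1/2) (- sqrt 3 / 2)"
  "cis (2 * pi * of_rat (1/6)) = Complex (1/2) (sqrt 3 / 2)"
  "cis (2 * pi * of_rat (5/6)) = Complex (1/2) (- sqrt 3 / 2)"
proof -
  have c3: "cis (pi / 3) = Complex (1/2) (sqrt 3 / 2)"
    by (simp add: complex_eq_iff cos_60 sin_60)
  have cpi: "cis pi = -1" by (simp add: complex_eq_iff)
  \<comment> \<open>De Moivre reduces the fourths, thirds and sixths to one basic angle for each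
    denominator.\<close>
  have pow: "cis (2 * pi * of_rat (of_nat n / of_nat d)) = cis (2 * pi / of_nat d) ^ n" for n d
    by (simp add: of_rat_divide DeMoivre field_simps)
  show "cis (2 * pi * of_rat 1) = 1" "cis (2 * pi * of_rat (1/2)) = -1"
    by (simp_all add: of_rat_divide complex_eq_iff)
  show "cis (2 * pi * of_rat (1/4)) = \<i>" "cis (2 * pi * of_rat (3/4)) = - \<i>"
    using pow[of 1 4] pow[of 3 4] by (simp_all add: power3_eq_cube)
  have "2 * pi / 3 = pi / 3 + pi / 3" by simp
  then have c3': "cis (2 * pi / 3) = Complex (-1/2) (sqrt 3 / 2)"
    unfolding \<open>2 * pi / 3 = pi / 3 + pi / 3\<close> cis_mult[symmetric] c3 by (simp add: complex_eq_iff)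
  show "cis (2 * pi * of_rat (1/3)) = Complex (-1/2) (sqrt 3 / 2)"
    "cis (2 * pi * of_rat (2/3)) = Complex (-1/2) (- sqrt 3 / 2)"
    using pow[of 1 3] pow[of 2 3] by (simp_all add: c3' power2_eq_square complex_eq_iff)
  show "cis (2 * pi * of_rat (1/6)) = Complex (1/2) (sqrt 3 / 2)"
    "cis (2 * pi * of_rat (5/6)) = Complex (1/2) (- sqrt 3 / 2)"
    using pow[of 1 6] pow[of 5 6] by (simp_all add: c3 eval_nat_numeral complex_eq_iff)
qed

lemma root_poly_values:
  "root_poly {#1/2, 1/4, 3/4#} = [:1, 1, 1, 1:]"
  "root_poly {#1/2, 1/6, 5/6#} = [:1, 0, 0, 1:]"
  "root_poly {#1, 1/3, 2/3#} = [:-1, 0, 0, 1:]"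
  "root_poly {#1, 1/4, 3/4#} = [:-1, 1, -1, 1:]"
  unfolding root_poly_def
  by (simp_all only: image_mset_add_mset prod_mset.insert image_mset_empty prod_mset.empty cis_values)
     (simp_all add: complex_eq_iff numeral_eq_Suc)

lemma monom_minus_one_values:
  "Polynomial.monom 1 1 - 1 = ([:-1, 1:] :: complex poly)"
  "Polynomial.monom 1 2 - 1 = ([:-1, 0, 1:] :: complex poly)"
  "Polynomial.monom 1 3 - 1 = ([:-1, 0, 0, 1:] :: complex poly)"
  "Polynomial.monom 1 4 - 1 = ([:-1, 0, 0, 0, 1:] :: complex poly)"
  "Polynomial.monom 1 6 - 1 = ([:-1, 0, 0, 0, 0, 0, 1:] :: complex poly)"
  by (simp_all add: numeral_eq_Suc monom_Suc one_pCons)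

text \<open>These rest on \<open>(X+1)(X^2+1) = (X^4-1)/(X-1)\<close>,
  \<open>X^3+1 = (X^6-1)/(X^3-1)\<close> and
  \<open>(X-1)(X^2+1) = (X-1)(X^4-1)/(X^2-1)\<close>.\<close>

lemma cyc_data_values:
  "cyc_data {#1/2, 1/4, 3/4#} {#1, 1/3, 2/3#} {#4#} {#1, 3#}"
  "cyc_data {#1/2, 1/6, 5/6#} {#1, 1/4, 3/4#} {#6, 2#} {#3, 1, 4#}"
  "cyc_data {#1/2, 1/6, 5/6#} {#1, 1/3, 2/3#} {#6#} {#3, 3#}"
  unfolding cyc_data_def root_poly_values cyc_poly_def
  by (simp_all only: image_mset_add_mset prod_mset.insert image_mset_empty prod_mset.empty
      monom_minus_one_values)
     (simp_all add: eq_fract)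

section \<open>Characters and Gauss sums of the prime field\<close>

lemma power_eq_power_iff_cong:
  fixes a :: "'a::field"
  assumes "a \<noteq> 0" and ord: "\<And>n. a ^ n = 1 \<longleftrightarrow> m dvd n"
  shows "a ^ i = a ^ j \<longleftrightarrow> [i = j] (mod m)"
proof (induction i j rule: linorder_wlog)
  case (le i j)
  have "a ^ j = a ^ i * a ^ (j - i)" using le by (simp flip: power_add)
  then have "a ^ i = a ^ j \<longleftrightarrow> a ^ (j - i) = 1" using assms(1) by auto
  also have "\<dots> \<longleftrightarrow> [i = j] (mod m)"
    using le by (simp add: ord cong_sym_eq[of i] cong_altdef_nat)
  finally show ?case .
qed (auto simp: cong_sym_eq eq_commute)

text \<open>The residue class of an integer primitive root has the right order; its
  \<open>p - 1\<close> distinct powers then exhaust the nonzero elements by counting.\<close>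

lemma mod_ring_primitive_root:
  obtains g :: "'p::prime_card mod_ring"
  where "g \<noteq> 0" and "\<And>n. g ^ n = 1 \<longleftrightarrow> CARD('p) - 1 dvd n" and "\<And>x. x \<noteq> 0 \<Longrightarrow> \<exists>n. x = g ^ n"
proof -
  let ?p = "CARD('p)"
  have p: "prime ?p" by (rule prime_card)
  obtain r where r: "residue_primroot ?p r" using prime_primitive_root_exists[OF prime_gt_1_nat[OF p] p] ..
  define g :: "'p mod_ring" where "g = of_nat r"
  have ord: "g ^ n = 1 \<longleftrightarrow> ?p - 1 dvd n" for n
  proof -
    have "g ^ n = 1 \<longleftrightarrow> (of_nat (r ^ n) :: 'p mod_ring) = of_nat 1" by (simp add: g_def)
    also have "\<dots> \<longleftrightarrow> [r ^ n = 1] (mod ?p)" by (simp only: of_nat_eq_iff_cong_CHAR semiring_char_mod_ring)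
    also have "\<dots> \<longleftrightarrow> ?p - 1 dvd n"
      using r p ord_divides[of r n "CARD('p)"] by (simp add: residue_primroot_def totient_prime)
    finally show ?thesis .
  qed
  have p1: "0 < ?p - 1" using prime_gt_1_nat[OF p] by simp
  have "g ^ (?p - 1) = 1" by (simp add: ord)
  then have g0: "g \<noteq> 0" using p1 by (auto simp: power_0_left)
  have "inj_on (\<lambda>n. g ^ n) {..<?p - 1}"
    by (rule inj_onI) (simp add: power_eq_power_iff_cong[OF g0 ord] cong_less_modulus_unique_nat)
  then have "card ((\<lambda>n. g ^ n) ` {..<?p - 1}) = card (UNIV - {0 :: 'p mod_ring})"
    by (simp add: card_image card_Diff_subset)
  then have "(\<lambda>n. g ^ n) ` {..<?p - 1} = UNIV - {0}"
    by (intro card_subset_eq) (use g0 in auto)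
  then show thesis using that[OF g0 ord] by blast
qed

text \<open>A discrete logarithm gives one injective character, and it is a power of \<open>\<omega>\<close>.\<close>

lemma generates_chars_kernel:
  fixes \<omega> :: "'p::prime_card mod_ring \<Rightarrow> complex"
  assumes "generates_chars \<omega>" and "x \<noteq> 0" and "\<omega> x = 1"
  shows "x = 1"
proof -
  let ?m = "CARD('p) - 1"
  obtain g :: "'p mod_ring" where g: "g \<noteq> 0" "\<And>n. g ^ n = 1 \<longleftrightarrow> ?m dvd n"
    and surj: "\<And>x. x \<noteq> 0 \<Longrightarrow> \<exists>n. x = g ^ n"
    by (rule mod_ring_primitive_root[where 'p='p]) blast
  have m: "0 < ?m" using prime_gt_1_nat[OF prime_card[where 'a='p]] by simp
  define z where "z = cis (2 * pi * real 1 / real ?m)"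
  have z: "z \<noteq> 0" "z ^ n = 1 \<longleftrightarrow> ?m dvd n" for n
    unfolding z_def cis_root_power_eq_1_iff[OF m] by simp_all
  \<comment> \<open>The choice of logarithm does not matter, since \<open>z\<close> and
    \<open>g\<close> both have order \<open>p - 1\<close>.\<close>
  define \<psi> where "\<psi> y = (if y = 0 then 0 else z ^ (SOME n. y = g ^ n))" for y
  have \<psi>: "\<psi> (g ^ n) = z ^ n" for n
  proof -
    have "g ^ n = g ^ (SOME k. g ^ n = g ^ k)" by (rule someI_ex) blast
    then show ?thesis
      using g(1) by (simp add: \<psi>_def power_eq_power_iff_cong[OF g] power_eq_power_iff_cong[OF z] cong_sym_eq)
  qed
  have "\<psi> (a * b) = \<psi> a * \<psi> b" for a b
  proof (cases "a = 0 \<or> b = 0")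
    case False
    then obtain i j where "a = g ^ i" "b = g ^ j" using surj by blast
    then show ?thesis using \<psi>[of i] \<psi>[of j] \<psi>[of "i + j"] by (simp add: power_add)
  qed (auto simp: \<psi>_def)
  then have "mult_char \<psi>"
    using \<psi>[of 0] by (simp add: mult_char_def \<psi>_def)
  then obtain k where k: "\<psi> = char_powi \<omega> k" using assms(1) by (auto simp: generates_chars_def)
  obtain n where n: "x = g ^ n" using surj[OF assms(2)] ..
  have "z ^ n = 1" using assms(2,3) \<psi>[of n] by (simp add: k n[symmetric] char_powi_def)
  then show ?thesis using g z n by simp
qed

section \<open>Powers of the generating character and their orthogonality\<close>

locale finite_field_chars =
  fixes \<omega> :: "'p::prime_card mod_ring \<Rightarrow> complex" and \<zeta> :: complex
  assumes card_gt_2: "2 < CARD('p)"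
    and generates: "generates_chars \<omega>"
    and primitive: "primitive_root_of_unity CARD('p) \<zeta>"
begin

abbreviation chr :: "int \<Rightarrow> 'p mod_ring \<Rightarrow> complex" where "chr \<equiv> char_powi \<omega>"

abbreviation G :: "int \<Rightarrow> complex" where "G j \<equiv> gauss_sum \<zeta> (chr j)"

text \<open>Half the period of the exponents of \<omega>: characters depend on \<open>j\<close>
  modulo \<open>2 * h\<close>, and \<open>chr h\<close> turns out to be \<phi>.\<close>

definition h :: int where "h = int ((CARD('p) - 1) div 2)"

text \<open>The additive character of the field that enters the Gauss sums.\<close>

definition ad :: "'p mod_ring \<Rightarrow> complex" where "ad x = \<zeta> powi to_int_mod_ring x"

lemma q_minus_1: "int (CARD('p) - 1) = 2 * h" "0 < h" "complex_of_nat CARD('p) = 2 * of_int h + 1"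
proof -
  have "odd CARD('p)" using prime_odd_nat[OF prime_card[where 'a='p]] card_gt_2 by simp
  then obtain n where n: "CARD('p) = 2 * n + 1" by (rule oddE)
  have h: "h = int n" by (simp add: h_def n)
  show "int (CARD('p) - 1) = 2 * h" "0 < h" "complex_of_nat CARD('p) = 2 * of_int h + 1"
    using card_gt_2 by (simp_all add: h n)
qed

lemma q_nonzero: "complex_of_nat CARD('p) \<noteq> 0" using card_gt_2 by simp

lemma of_nat_nonzero: "\<not> CARD('p) dvd n \<Longrightarrow> (of_nat n :: 'p mod_ring) \<noteq> 0"
  using of_nat_0_mod_ring_dvd by blast

lemma two_nonzero: "(2 :: 'p mod_ring) \<noteq> 0" "(4 :: 'p mod_ring) \<noteq> 0"
proof -
  show "(2 :: 'p mod_ring) \<noteq> 0" using of_nat_nonzero[of 2] card_gt_2 dvd_imp_le[of "CARD('p)" 2] by fastforce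
  then have "(2 * 2 :: 'p mod_ring) \<noteq> 0" by (simp only: mult_eq_0_iff) simp
  then show "(4 :: 'p mod_ring) \<noteq> 0" by simp
qed

lemma omega_mult: "\<omega> (x * y) = \<omega> x * \<omega> y" and omega_1: "\<omega> 1 = 1" and omega_0: "\<omega> 0 = 0"
  using generates by (auto simp: generates_chars_def mult_char_def)

lemma omega_power: "\<omega> (x ^ n) = \<omega> x ^ n"
  by (induction n) (simp_all add: omega_mult omega_1)

lemma omega_nonzero: "x \<noteq> 0 \<Longrightarrow> \<omega> x \<noteq> 0"
  using omega_mult[of x "inverse x"] by (auto simp: omega_1)

lemma omega_eq_1_iff: "x \<noteq> 0 \<Longrightarrow> \<omega> x = 1 \<longleftrightarrow> x = 1"
  using generates_chars_kernel[OF generates] omega_1 by blast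

lemma chr_zero [simp]: "chr j 0 = 0" by (simp add: char_powi_def)

lemma chr_one [simp]: "chr j 1 = 1" by (simp add: char_powi_def omega_1)

lemma chr_eq_0_iff [simp]: "chr j x = 0 \<longleftrightarrow> x = 0"
  by (auto simp: char_powi_def omega_nonzero)

lemma chr_mult: "chr j (x * y) = chr j x * chr j y"
  by (simp add: char_powi_def omega_mult power_int_mult_distrib)

lemma chr_add: "chr (i + j) x = chr i x * chr j x"
  by (simp add: char_powi_def power_int_add omega_nonzero)

lemma chr_mult_index: "x \<noteq> 0 \<Longrightarrow> chr (int n * j) x = chr j (x ^ n)"
  by (simp add: char_powi_def omega_power power_int_mult)

lemma chr_uminus: "x \<noteq> 0 \<Longrightarrow> chr (- j) x = inverse (chr j x)"
  by (simp add: char_powi_def power_int_minus)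

lemma chr_inverse: "chr j (inverse x) = inverse (chr j x)"
proof (cases "x = 0")
  case False
  then have "chr j x * chr j (inverse x) = 1" by (simp flip: chr_mult)
  then show ?thesis by (simp add: inverse_unique)
qed simp

lemma fermat: "x \<noteq> 0 \<Longrightarrow> (x :: 'p mod_ring) ^ (CARD('p) - 1) = 1"
proof -
  assume "x \<noteq> 0"
  obtain g :: "'p mod_ring" where "\<And>n. g ^ n = 1 \<longleftrightarrow> CARD('p) - 1 dvd n" "\<And>x. x \<noteq> 0 \<Longrightarrow> \<exists>n. x = g ^ n"
    by (rule mod_ring_primitive_root[where 'p='p]) blast
  moreover from this \<open>x \<noteq> 0\<close> obtain n where "x = g ^ n" by blast
  ultimately show ?thesis by (simp flip: power_mult)
qed

lemma chr_trivial: "2 * h dvd j \<Longrightarrow> chr j x = of_bool (x \<noteq> 0)"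
proof -
  assume "2 * h dvd j"
  then obtain i where j: "j = int (CARD('p) - 1) * i" unfolding q_minus_1 by (rule dvdE)
  show ?thesis
    using chr_mult_index[of x "CARD('p) - 1" i] fermat[of x] by (cases "x = 0") (simp_all add: j)
qed

lemma chr_cong: "2 * h dvd i - j \<Longrightarrow> chr i = chr j"
proof
  fix x
  assume "2 * h dvd i - j"
  then show "chr i x = chr j x"
    using chr_add[of "i - j" j x] by (cases "x = 0") (simp_all add: chr_trivial)
qed

text \<open>A primitive root \<open>g\<close> is a witness: \<open>chr j g\<close> is \<omega> at
  \<open>g ^ r\<close> with \<open>r\<close> the residue of \<open>j\<close>, and \<omega> takes the
  value \<open>1\<close> only at \<open>1\<close>.\<close>

lemma chr_nontrivial:
  assumes "\<not> 2 * h dvd j"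
  obtains x where "x \<noteq> 0" "chr j x \<noteq> 1"
proof -
  obtain g :: "'p mod_ring" where g: "g \<noteq> 0" "\<And>n. g ^ n = 1 \<longleftrightarrow> CARD('p) - 1 dvd n"
    using mod_ring_primitive_root by metis
  define r where "r = nat (j mod (2 * h))"
  have r: "int r = j mod (2 * h)" using q_minus_1 by (simp add: r_def)
  have "chr j g = chr (int r) g" by (rule fun_cong[OF chr_cong]) (simp add: r minus_mod_eq_mult_div)
  also have "\<dots> = \<omega> (g ^ r)" using g(1) by (simp add: char_powi_def omega_power)
  finally have eq: "chr j g = \<omega> (g ^ r)" .
  have "chr j g \<noteq> 1"
  proof
    assume "chr j g = 1"
    then have "CARD('p) - 1 dvd r" using g by (simp add: eq omega_eq_1_iff)
    then have "2 * h dvd int r" by (metis int_dvd_int_iff q_minus_1(1))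
    with assms show False by (simp add: r dvd_mod_iff)
  qed
  with g(1) show thesis using that by blast
qed

lemma bij_times: "a \<noteq> 0 \<Longrightarrow> bij ((*) (a :: 'p mod_ring))"
  by (rule bij_betw_byWitness[where f' = "\<lambda>x. x / a"]) auto

lemma sum_times: "a \<noteq> 0 \<Longrightarrow> (\<Sum>x\<in>UNIV. f (a * x)) = (\<Sum>x\<in>UNIV. f (x :: 'p mod_ring))"
  using sum.reindex_bij_betw[OF bij_times] .

lemma sum_plus: "(\<Sum>x\<in>UNIV. f (a + x)) = (\<Sum>x\<in>UNIV. f (x :: 'p mod_ring))"
  by (rule sum.reindex_bij_betw) (rule bij_betw_byWitness[where f' = "\<lambda>x. x - a"], auto)

text \<open>For nontrivial \<open>chr j\<close>, scaling the variable by some \<open>a\<close> with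
  \<open>chr j a \<noteq> 1\<close> multiplies the sum by \<open>chr j a\<close>, so it
  vanishes.\<close>

lemma sum_chr: "(\<Sum>x\<in>UNIV. chr j x) = (if 2 * h dvd j then of_nat CARD('p) - 1 else 0)"
proof (cases "2 * h dvd j")
  case True
  have "(\<Sum>x\<in>UNIV. chr j x) = (\<Sum>x\<in>UNIV - {0 :: 'p mod_ring}. 1)"
    by (rule sum.mono_neutral_cong_right) (auto simp: chr_trivial[OF True])
  then show ?thesis using True card_gt_2 by (simp add: card_Diff_subset of_nat_diff)
next
  case False
  obtain a where a: "a \<noteq> 0" "chr j a \<noteq> 1" using chr_nontrivial[OF False] .
  have "chr j a * (\<Sum>x\<in>UNIV. chr j x) = (\<Sum>x\<in>UNIV. chr j x)"
    using sum_times[OF a(1), of "chr j"] by (simp add: chr_mult sum_distrib_left)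
  then show ?thesis using a(2) False by simp
qed

text \<open>The dual orthogonality: a full geometric series whose ratio \<open>\<omega> x\<close> is
  a \<open>(p-1)\<close>-th root of unity, equal to \<open>1\<close> only for
  \<open>x = 1\<close>.\<close>

lemma sum_chr_index:
  assumes "x \<noteq> 0"
  shows "(\<Sum>k=0..CARD('p)-2. chr (int k) x) = (if x = 1 then of_nat CARD('p) - 1 else 0)"
proof -
  have set: "{0..CARD('p)-2} = {..<CARD('p)-1}" using card_gt_2 by auto
  have eq: "chr (int k) x = \<omega> x ^ k" for k using assms by (simp add: char_powi_def)
  show ?thesis
  proof (cases "x = 1")
    case True
    then show ?thesis using card_gt_2 by (simp add: set of_nat_diff)
  next
    case False
    have "\<omega> x ^ (CARD('p) - 1) = 1" using fermat[OF assms] by (simp flip: omega_power add: omega_1)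
    then show ?thesis
      using False assms by (simp add: set eq geometric_sum omega_eq_1_iff)
  qed
qed

text \<open>By Euler's criterion \<open>x ^ h\<close> is the Legendre symbol read in the field;
  applying \<omega> to it gives \<open>chr h x\<close>.\<close>

lemma quad_char_eq: "quad_char x = chr h x"
proof -
  have p: "prime CARD('p)" "2 < CARD('p)" using prime_card card_gt_2 by auto
  let ?L = "Legendre (to_int_mod_ring x) (int CARD('p))"
  have x: "of_int (to_int_mod_ring x) = x" by (simp add: of_int_of_int_mod_ring)
  have L: "of_int ?L = x ^ ((CARD('p) - 1) div 2)"
  proof -
    have "[?L = to_int_mod_ring x ^ ((CARD('p) - 1) div 2)] (mod int CARD('p))" by (rule euler_criterion[OF p])
    then have "(of_int ?L :: 'p mod_ring) = of_int (to_int_mod_ring x ^ ((CARD('p) - 1) div 2))"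
      by (simp only: of_int_eq_iff_cong_CHAR semiring_char_mod_ring)
    then show ?thesis by (simp add: x)
  qed
  show ?thesis
  proof (cases "x = 0")
    case True
    then show ?thesis by (simp add: quad_char_def Legendre_def to_int_mod_ring_hom.hom_zero)
  next
    case False
    have chr: "chr h x = \<omega> (of_int ?L)" using False by (simp add: L omega_power char_powi_def h_def)
    have "?L \<noteq> 0" using L False by auto
    then consider "?L = 1" | "?L = -1" by (auto simp: Legendre_def split: if_splits)
    then show ?thesis
    proof cases
      case 1
      then show ?thesis by (simp add: chr quad_char_def omega_1)
    next
      case 2
      \<comment> \<open>So \<open>\<omega> (-1)\<close> is a sign, and faithfulness leaves only
        \<open>-1\<close>.\<close>
      have "\<omega> (-1) * \<omega> (-1) = 1" by (simp flip: omega_mult add: omega_1)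
      then have "\<omega> (-1) = 1 \<or> \<omega> (-1) = -1" by (simp add: square_eq_1_iff)
      moreover have "\<omega> (-1) \<noteq> 1"
      proof
        assume "\<omega> (-1) = 1"
        then have "(-1 :: 'p mod_ring) = 1" by (simp add: omega_eq_1_iff)
        then have "(1 + 1 :: 'p mod_ring) = 0" by (metis add.right_inverse)
        with two_nonzero show False by simp
      qed
      ultimately show ?thesis using 2 by (simp add: chr quad_char_def)
    qed
  qed
qed

section \<open>Additive characters and products of Gauss sums\<close>

lemma ad_add: "ad (x + y) = ad x * ad y"
proof -
  have z: "\<zeta> ^ CARD('p) = 1" using primitive by (simp add: primitive_root_of_unity_def)
  then have z0: "\<zeta> \<noteq> 0" using card_gt_2 by (auto simp: power_0_left)
  \<comment> \<open>The representative of a sum is reduced modulo \<open>p\<close>, which \<zeta>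
    does not see.\<close>
  have mod: "\<zeta> powi (n mod int CARD('p)) = \<zeta> powi n" for n
  proof -
    have "\<zeta> powi n = \<zeta> powi (int CARD('p) * (n div int CARD('p)) + n mod int CARD('p))" by simp
    also have "\<dots> = \<zeta> powi (n mod int CARD('p))"
      using z0 by (subst power_int_add) (simp_all add: z power_int_mult)
    finally show ?thesis ..
  qed
  show ?thesis using z0 by (simp add: ad_def to_int_mod_ring_add mod power_int_add)
qed

lemma ad_0 [simp]: "ad 0 = 1" by (simp add: ad_def to_int_mod_ring_hom.hom_zero)

text \<open>Translation by \<open>1\<close> multiplies the full sum by
  \<open>\<zeta> \<noteq> 1\<close>; a nonzero \<open>t\<close> merely permutes the field.\<close>

lemma sum_ad: "(\<Sum>x\<in>UNIV. ad (x * t)) = (if t = 0 then of_nat CARD('p) else 0)"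
proof (cases "t = 0")
  case False
  have "ad 1 = \<zeta>" by (simp add: ad_def to_int_mod_ring_hom.hom_one)
  moreover have "\<zeta> \<noteq> 1" using primitive card_gt_2
    by (auto simp: primitive_root_of_unity_def intro!: exI[of _ 1])
  moreover have "(\<Sum>x\<in>UNIV. ad x) = ad 1 * (\<Sum>x\<in>UNIV. ad x)"
    using sum_plus[of ad 1] by (simp add: ad_add sum_distrib_left)
  ultimately have "(\<Sum>x\<in>UNIV. ad x) = 0" by simp
  then show ?thesis using False sum_times[OF False, of ad] by (simp add: mult.commute)
qed simp

lemma gauss_sum_chr: "G j = (\<Sum>x\<in>UNIV. chr j x * ad x)"
  unfolding gauss_sum_def ad_def by (rule sum.mono_neutral_left) auto

lemma gauss_cong: "2 * h dvd i - j \<Longrightarrow> G i = G j"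
  using chr_cong by metis

text \<open>\<open>chr 0\<close> is the indicator of the nonzero elements, so only the term at
  \<open>y = 0\<close> is missing from \<open>sum_ad\<close>.\<close>

lemma sum_chr_0_ad: "(\<Sum>y\<in>UNIV. chr 0 y * ad (y * u)) = (if u = 0 then of_nat CARD('p) else 0) - 1"
proof -
  have "(\<Sum>y\<in>UNIV. chr 0 y * ad (y * u)) = (\<Sum>y\<in>UNIV. ad (y * u) - of_bool (y = 0))"
    by (rule sum.cong) (auto simp: chr_trivial)
  also have "\<dots> = (\<Sum>y\<in>UNIV. ad (y * u)) - (\<Sum>y\<in>UNIV. of_bool (y = (0 :: 'p mod_ring)))"
    by (rule sum_subtractf)
  also have "(\<Sum>y\<in>UNIV. of_bool (y = (0 :: 'p mod_ring))) = (1 :: complex)" by (simp add: of_bool_def)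
  finally show ?thesis by (simp add: sum_ad)
qed

lemma gauss_trivial: "2 * h dvd j \<Longrightarrow> G j = -1"
  using gauss_cong[of j 0] sum_chr_0_ad[of 1] by (simp add: gauss_sum_chr)

text \<open>Substitute \<open>y / u\<close> for \<open>y\<close>; at \<open>u = 0\<close> both sides
  vanish because the character is nontrivial.\<close>

lemma sum_chr_ad_scale:
  assumes "\<not> 2 * h dvd j"
  shows "(\<Sum>y\<in>UNIV. chr j y * ad (y * u)) = chr (- j) u * G j"
proof (cases "u = 0")
  case False
  have "chr j u * (\<Sum>y\<in>UNIV. chr j y * ad (y * u)) = G j"
    using sum_times[OF False, of "\<lambda>x. chr j x * ad x"]
    by (simp add: gauss_sum_chr sum_distrib_left chr_mult mult_ac)
  then show ?thesis using False by (simp add: chr_uminus field_simps)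
qed (use assms in \<open>simp add: sum_chr\<close>)

text \<open>The substitution \<open>x = y * t\<close> isolates an inner sum over \<open>y\<close>,
  which \<open>sum_chr_0_ad\<close> evaluates for \<open>i + j = 0\<close> and
  \<open>sum_chr_ad_scale\<close> for nontrivial \<open>chr (i + j)\<close>.\<close>

lemma gauss_mult:
  "G i * G j = (\<Sum>t\<in>UNIV. chr i t * (\<Sum>y\<in>UNIV. chr (i + j) y * ad (y * (t + 1))))"
proof -
  have "G i * G j = (\<Sum>y\<in>UNIV. \<Sum>x\<in>UNIV. chr i x * ad x * (chr j y * ad y))"
    by (subst sum.swap) (simp add: gauss_sum_chr sum_product)
  also have "\<dots> = (\<Sum>y\<in>UNIV. \<Sum>t\<in>UNIV. chr i t * (chr (i + j) y * ad (y * (t + 1))))"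
  proof (rule sum.cong[OF refl])
    fix y :: "'p mod_ring"
    show "(\<Sum>x\<in>UNIV. chr i x * ad x * (chr j y * ad y)) =
      (\<Sum>t\<in>UNIV. chr i t * (chr (i + j) y * ad (y * (t + 1))))"
    proof (cases "y = 0")
      case False
      have "(\<Sum>x\<in>UNIV. chr i x * ad x * (chr j y * ad y)) =
        (\<Sum>t\<in>UNIV. chr i (y * t) * ad (y * t) * (chr j y * ad y))"
        by (rule sum_times[OF False, symmetric])
      then show ?thesis by (simp add: chr_mult chr_add ad_add distrib_left mult_ac)
    qed simp
  qed
  finally show ?thesis by (subst (asm) sum.swap) (simp add: sum_distrib_left)
qed

text \<open>In \<open>gauss_mult\<close> the inner sum is \<open>p * [t = -1] - 1\<close>. The
  trivial character gives \<open>p - (p - 1) = 1\<close>.\<close>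

lemma gauss_reflection: "G j * G (- j) = (if 2 * h dvd j then 1 else of_nat CARD('p) * chr j (-1))"
proof -
  have "G j * G (- j) = (\<Sum>t\<in>UNIV. chr j t * ((if t = - 1 then of_nat CARD('p) else 0) - 1))"
    by (simp add: gauss_mult sum_chr_0_ad eq_neg_iff_add_eq_0)
  also have "\<dots> = (\<Sum>t\<in>UNIV. (if t = - 1 then of_nat CARD('p) * chr j t else 0)) - (\<Sum>t\<in>UNIV. chr j t)"
    unfolding sum_subtractf[symmetric] by (rule sum.cong) (auto simp: right_diff_distrib)
  also have "\<dots> = of_nat CARD('p) * chr j (-1) - (\<Sum>t\<in>UNIV. chr j t)" by simp
  finally show ?thesis by (auto simp: sum_chr chr_trivial right_diff_distrib)
qed

lemma gauss_nonzero: "G j \<noteq> 0"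
  using gauss_reflection[of j] q_nonzero by (auto split: if_splits)

lemma h_not_dvd: "\<not> 2 * h dvd h"
  using q_minus_1(2) zdvd_imp_le[of "2 * h" h] by auto

lemma gauss_h_square: "G h * G h = of_nat CARD('p) * chr h (-1)"
  using gauss_reflection[of h] gauss_cong[of "- h" h] h_not_dvd by simp

lemma chr_h_square: "x \<noteq> 0 \<Longrightarrow> chr h x * chr h x = 1"
  using chr_add[of h h x] by (simp add: chr_trivial)

text \<open>The two characters have product \<phi>, so \<open>G h\<close> splits off and a Jacobi
  sum remains.\<close>

lemma gauss_jacobi_quadratic:
  "G (h + j) * G (- j) = G h * (\<Sum>t\<in>UNIV. chr (h + j) t * chr h (t + 1))"
proof -
  have "chr (- h) = chr h" by (rule chr_cong) simp
  then show ?thesis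
    by (subst gauss_mult) (simp add: sum_chr_ad_scale[OF h_not_dvd] sum_distrib_left mult_ac)
qed

text \<open>Scaling two variables by the third makes the characters of the scale cancel; summing
  over the scale gives \<open>p\<close> times the indicator of \<open>x + y + 1 = 0\<close>, minus
  \<open>1\<close>. The subtracted product is nonzero only if both \<open>chr i\<close> and
  \<open>chr j\<close> are trivial.\<close>

lemma gauss_jacobi:
  assumes "2 * h dvd i + j + l"
  shows "G i * G j * G l =
    of_nat CARD('p) * (\<Sum>x\<in>UNIV. chr i x * chr j (- 1 - x)) - (\<Sum>x\<in>UNIV. chr i x) * (\<Sum>x\<in>UNIV. chr j x)"
proof -
  have l: "G l = G (- (i + j))" using assms by (intro gauss_cong) (simp add: algebra_simps)
  have "G i * (G j * G l) = (\<Sum>x\<in>UNIV. \<Sum>y\<in>UNIV. \<Sum>z\<in>UNIV.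
      chr i x * chr j y * (chr (- (i + j)) z * ad (x + y + z)))"
  proof -
    have "G i * (G j * G l) = (\<Sum>x\<in>UNIV. \<Sum>y\<in>UNIV. \<Sum>z\<in>UNIV.
        chr i x * ad x * ((chr j y * ad y) * (chr (- (i + j)) z * ad z)))"
      unfolding l by (simp only: gauss_sum_chr sum_product) (simp only: sum_distrib_left)
    then show ?thesis by (simp add: ad_add mult_ac)
  qed
  also have "\<dots> = (\<Sum>z\<in>UNIV. \<Sum>x\<in>UNIV. \<Sum>y\<in>UNIV.
      chr i x * chr j y * (chr (- (i + j)) z * ad (x + y + z)))"
    by (subst (2) sum.swap, subst sum.swap) simp
  also have "\<dots> = (\<Sum>z\<in>UNIV. \<Sum>x\<in>UNIV. \<Sum>y\<in>UNIV. chr i x * chr j y * (chr 0 z * ad (z * (x + y + 1))))"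
  proof (rule sum.cong[OF refl])
    fix z :: "'p mod_ring"
    show "(\<Sum>x\<in>UNIV. \<Sum>y\<in>UNIV. chr i x * chr j y * (chr (- (i + j)) z * ad (x + y + z))) =
      (\<Sum>x\<in>UNIV. \<Sum>y\<in>UNIV. chr i x * chr j y * (chr 0 z * ad (z * (x + y + 1))))"
    proof (cases "z = 0")
      case False
      \<comment> \<open>Replace \<open>x\<close> and \<open>y\<close> by \<open>z * x\<close> and
        \<open>z * y\<close>.\<close>
      have "(\<Sum>x\<in>UNIV. \<Sum>y\<in>UNIV. chr i x * chr j y * (chr (- (i + j)) z * ad (x + y + z))) =
        (\<Sum>x\<in>UNIV. \<Sum>y\<in>UNIV. chr i (z * x) * chr j (z * y) * (chr (- (i + j)) z * ad (z * x + z * y + z)))"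
        by (subst sum_times[OF False, symmetric], subst (2) sum_times[OF False, symmetric]) (rule refl)
      also have "\<dots> = (\<Sum>x\<in>UNIV. \<Sum>y\<in>UNIV. chr i x * chr j y * (chr 0 z * ad (z * (x + y + 1))))"
      proof (intro sum.cong refl)
        fix x y
        have "chr 0 z = chr i z * chr j z * chr (- (i + j)) z" by (simp flip: chr_add)
        then show "chr i (z * x) * chr j (z * y) * (chr (- (i + j)) z * ad (z * x + z * y + z)) =
          chr i x * chr j y * (chr 0 z * ad (z * (x + y + 1)))"
          by (simp add: chr_mult distrib_left mult_ac)
      qed
      finally show ?thesis .
    qed simp
  qed
  also have "\<dots> = (\<Sum>x\<in>UNIV. \<Sum>y\<in>UNIV. \<Sum>z\<in>UNIV. chr i x * chr j y * (chr 0 z * ad (z * (x + y + 1))))"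
    by (subst sum.swap, subst (2) sum.swap) simp
  also have "\<dots> = (\<Sum>x\<in>UNIV. \<Sum>y\<in>UNIV. chr i x * chr j y * ((if y = - 1 - x then of_nat CARD('p) else 0) - 1))"
  proof (intro sum.cong refl)
    fix x y :: "'p mod_ring"
    have "x + y + 1 = 0 \<longleftrightarrow> y = - 1 - x" by (simp add: eq_diff_eq eq_neg_iff_add_eq_0 ac_simps)
    then show "(\<Sum>z\<in>UNIV. chr i x * chr j y * (chr 0 z * ad (z * (x + y + 1)))) =
      chr i x * chr j y * ((if y = - 1 - x then of_nat CARD('p) else 0) - 1)"
      by (simp add: sum_chr_0_ad flip: sum_distrib_left)
  qed
  also have "\<dots> = (\<Sum>x\<in>UNIV. (\<Sum>y\<in>UNIV. if y = - 1 - x then of_nat CARD('p) * (chr i x * chr j y) else 0)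
      - (\<Sum>y\<in>UNIV. chr i x * chr j y))"
    unfolding sum_subtractf[symmetric] by (intro sum.cong refl) (auto simp: right_diff_distrib)
  also have "\<dots> = of_nat CARD('p) * (\<Sum>x\<in>UNIV. chr i x * chr j (- 1 - x)) - (\<Sum>x\<in>UNIV. chr i x) * (\<Sum>x\<in>UNIV. chr j x)"
    by (simp add: sum_subtractf sum_product flip: sum_distrib_left)
  finally show ?thesis by (simp add: mult.assoc)
qed

section \<open>The duplication formula\<close>

lemma sum_squares_eq:
  fixes f :: "'p mod_ring \<Rightarrow> complex"
  shows "(\<Sum>u\<in>UNIV. f (u ^ 2)) = (\<Sum>w\<in>UNIV. (1 + chr h w) * f w)"
proof -
  \<comment> \<open>The number of square roots is two, one or none as \<open>w\<close> is a nonzero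
    square, zero or a nonsquare.\<close>
  have card: "of_nat (card {u. u ^ 2 = w}) = 1 + chr h w" for w :: "'p mod_ring"
  proof (cases "\<exists>v. w = v ^ 2")
    case True
    then obtain v where v: "w = v ^ 2" ..
    have set: "{u. u ^ 2 = w} = {v, - v}" by (auto simp: v power2_eq_iff)
    show ?thesis
    proof (cases "v = 0")
      case False
      have "v \<noteq> - v"
      proof
        assume "v = - v"
        then have "v + v = 0" by (metis add.right_inverse)
        then have "2 * v = 0" by (simp only: mult_2)
        with False two_nonzero show False by simp
      qed
      moreover have "chr h w = 1" using False by (simp add: v power2_eq_square chr_mult chr_h_square)
      ultimately show ?thesis unfolding set by simp
    qed (simp add: set v)
  next
    case False
    then have "w \<noteq> 0" by (metis zero_power2)
    have "\<not> QuadRes (int CARD('p)) (to_int_mod_ring w)"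
    proof
      assume "QuadRes (int CARD('p)) (to_int_mod_ring w)"
      then obtain y where "[y ^ 2 = to_int_mod_ring w] (mod int CARD('p))" by (auto simp: QuadRes_def)
      then have "(of_int (y ^ 2) :: 'p mod_ring) = of_int (to_int_mod_ring w)"
        by (simp only: of_int_eq_iff_cong_CHAR semiring_char_mod_ring)
      moreover have "of_int (to_int_mod_ring w) = w" by (simp add: of_int_of_int_mod_ring)
      ultimately have "w = of_int y ^ 2" by simp
      with False show False by blast
    qed
    moreover have "quad_char w \<noteq> 0" using \<open>w \<noteq> 0\<close> by (simp add: quad_char_eq)
    ultimately have "quad_char w = -1" by (auto simp: quad_char_def Legendre_def split: if_splits)
    moreover have "{u. u ^ 2 = w} = {}" using False by auto
    ultimately show ?thesis by (simp add: quad_char_eq)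
  qed
  have "(\<Sum>u\<in>UNIV. f (u ^ 2)) = (\<Sum>w\<in>UNIV. \<Sum>u\<in>{u\<in>UNIV. u ^ 2 = w}. f (u ^ 2))"
    by (rule sum.group[symmetric]) auto
  also have "\<dots> = (\<Sum>w\<in>UNIV. of_nat (card {u. u ^ 2 = w}) * f w)"
    by (rule sum.cong) auto
  finally show ?thesis by (simp add: card)
qed

text \<open>Completing the square: \<open>4 * x * (- 1 - x) = 1 - (1 + 2 * x)\<^sup>2\<close>.\<close>

lemma jacobi_square:
  assumes "\<not> 2 * h dvd j"
  shows "chr j 4 * (\<Sum>x\<in>UNIV. chr j x * chr j (- 1 - x)) =
    chr (h + j) (- 1) * (\<Sum>x\<in>UNIV. chr h x * chr j (- 1 - x))"
proof -
  have "chr j 4 * (\<Sum>x\<in>UNIV. chr j x * chr j (- 1 - x)) = (\<Sum>x\<in>UNIV. chr j (1 - (1 + 2 * x) ^ 2))"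
    unfolding sum_distrib_left
    by (intro sum.cong refl) (simp flip: chr_mult add: power2_eq_square algebra_simps)
  also have "\<dots> = (\<Sum>x\<in>UNIV. chr j (1 - x ^ 2))"
    using sum_times[OF two_nonzero(1), of "\<lambda>x. chr j (1 - (1 + x) ^ 2)"]
      sum_plus[of "\<lambda>x. chr j (1 - x ^ 2)" 1] by simp
  also have "\<dots> = (\<Sum>w\<in>UNIV. (1 + chr h w) * chr j (1 - w))"
    by (rule sum_squares_eq)
  also have "\<dots> = (\<Sum>w\<in>UNIV. (1 + chr h (- w)) * chr j (1 + w))"
    using sum_times[of "-1" "\<lambda>w. (1 + chr h w) * chr j (1 - w)"] by simp
  also have "\<dots> = (\<Sum>w\<in>UNIV. chr j (1 + w)) + (\<Sum>w\<in>UNIV. chr h (- w) * chr j (1 + w))"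
    by (simp add: distrib_right sum.distrib)
  \<comment> \<open>Of the factor \<open>1 + \<phi>\<close> from counting square roots, only the
    \<phi> part survives.\<close>
  also have "(\<Sum>w\<in>UNIV. chr j (1 + w)) = 0"
    using assms sum_plus[of "chr j" 1] by (simp add: sum_chr)
  also have "(\<Sum>w\<in>UNIV. chr h (- w) * chr j (1 + w)) =
    chr (h + j) (- 1) * (\<Sum>x\<in>UNIV. chr h x * chr j (- 1 - x))"
    unfolding sum_distrib_left
  proof (intro sum.cong refl)
    fix w :: "'p mod_ring"
    have "chr h (- w) = chr h (- 1) * chr h w" "chr j (1 + w) = chr j (- 1) * chr j (- 1 - w)"
      by (simp_all add: add.commute flip: chr_mult)
    then show "chr h (- w) * chr j (1 + w) = chr (h + j) (- 1) * (chr h w * chr j (- 1 - w))"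
      by (simp add: chr_add)
  qed
  finally show ?thesis by simp
qed

text \<open>\<open>inverse (wt j)\<close> is the contribution of a factor \<open>j\<close> to the weight \<open>p powi (s(k) - s(0))\<close>.\<close>

definition wt :: "int \<Rightarrow> complex" where "wt j = (if 2 * h dvd j then 1 else of_nat CARD('p))"

lemma wt_nonzero: "wt j \<noteq> 0" using q_nonzero by (simp add: wt_def)

text \<open>Hasse-Davenport for the quadratic character, with \<open>G (- j)\<close> kept on the
  left so that \<open>wt j\<close> absorbs the exceptional trivial case. Otherwise the index triples
  \<open>(-j, -j, 2j)\<close> and \<open>(h, -j, h + j)\<close> both lead to Jacobi sums, and
  \<open>jacobi_square\<close> compares these.\<close>

lemma gauss_duplication: "G (2 * j) * G (- j) * G h = wt j * chr j (- 4) * G (h + j)"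
proof (cases "2 * h dvd j")
  case True
  then have "G (h + j) = G h" by (intro gauss_cong) simp
  moreover have "2 * h dvd 2 * j" using True by (rule dvd_mult)
  ultimately show ?thesis using True two_nonzero by (simp add: wt_def gauss_trivial chr_trivial)
next
  case False
  let ?J = "\<Sum>x\<in>UNIV. chr (- j) x * chr (- j) (- 1 - x)"
  let ?K = "\<Sum>x\<in>UNIV. chr h x * chr (- j) (- 1 - x)"
  have j: "\<not> 2 * h dvd - j" using False by simp
  have "G (- j) * G (- j) * G (2 * j) = of_nat CARD('p) * ?J"
    using j by (subst gauss_jacobi) (simp_all add: sum_chr)
  moreover have "G h * G (- j) * G (h + j) = of_nat CARD('p) * ?K"
    using j by (subst gauss_jacobi) (simp_all add: sum_chr)
  moreover have "chr (- j) 4 * ?J = chr (h - j) (- 1) * ?K"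
    using jacobi_square[OF j] by simp
  ultimately have "chr (- j) 4 * (G (- j) * G (- j) * G (2 * j)) =
      chr (h - j) (- 1) * (G h * G (- j) * G (h + j))"
    by (simp add: mult.left_commute)
  then have eq: "chr (- j) 4 * (G (- j) * G (2 * j)) = chr (h - j) (- 1) * (G h * G (h + j))"
    using gauss_nonzero[of "- j"] by (simp add: mult_ac)
  \<comment> \<open>The extra \<open>chr h (- 1)\<close> comes from \<open>G h * G h\<close>
    below.\<close>
  have sign: "chr (h - j) (- 1) * chr h (- 1) = chr j (- 1)"
  proof -
    have "chr (h - j) (- 1) * chr h (- 1) = chr (- j) (- 1)"
      using chr_add[of h "- j" "- 1"] chr_h_square[of "-1"] by simp
    also have "\<dots> = chr j (- 1)"
      using chr_inverse[of j "-1"] by (simp add: chr_uminus)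
    finally show ?thesis .
  qed
  have "chr j 4 * chr (- j) 4 = 1" using two_nonzero by (simp add: chr_uminus)
  then have "G (2 * j) * G (- j) * G h = (chr j 4 * chr (- j) 4) * (G (2 * j) * G (- j) * G h)"
    by simp
  also have "\<dots> = chr j 4 * (chr (- j) 4 * (G (- j) * G (2 * j))) * G h"
    by (simp only: mult_ac)
  also have "\<dots> = chr j 4 * chr (h - j) (- 1) * (G h * G h) * G (h + j)"
    unfolding eq by (simp only: mult_ac)
  also have "\<dots> = of_nat CARD('p) * (chr j 4 * (chr (h - j) (- 1) * chr h (- 1))) * G (h + j)"
    unfolding gauss_h_square by (simp only: mult_ac)
  also have "chr j 4 * (chr (h - j) (- 1) * chr h (- 1)) = chr j (- 4)"
    unfolding sign by (simp flip: chr_mult)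
  finally show ?thesis using False by (simp add: wt_def)
qed

end

section \<open>Evaluation of the three sums\<close>

text \<open>\<open>An\<close> stands for \<open>p - 1\<close> dividing \<open>n * k\<close>; the
  premises are the divisibility relations that decide the minimum for the exponents
  \<open>(6, 2; 3, 1, 4)\<close>.\<close>

lemma min_of_bool_sum:
  "\<lbrakk>A3 \<longrightarrow> A6; A2 \<longrightarrow> A6; A2 \<longrightarrow> A4; A6 \<and> A4 \<longrightarrow> A2; A3 \<and> A4 \<longrightarrow> A1; A1 \<longrightarrow> A3\<rbrakk> \<Longrightarrow>
    min (of_bool A6 + of_bool A2) (of_bool A3 + of_bool A1 + of_bool A4) = (of_bool A3 + of_bool A2 :: nat)"
  by (cases A6; cases A4; cases A3; cases A2; cases A1; simp)

context finite_field_chars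
begin

lemma chr_uminus_inverse: "chr (- j) x = chr j (inverse x)"
  by (cases "x = 0") (simp_all add: chr_uminus chr_inverse)

lemma chr_multiple: "0 < n \<Longrightarrow> chr (int n * j) x = chr j (x ^ n)"
  using chr_mult_index[of x n j] by (cases "x = 0") (simp_all add: power_0_left)

lemma chr_h_mult_square: "y \<noteq> 0 \<Longrightarrow> chr h (y ^ 2 * z) = chr h z"
  by (simp add: chr_mult power2_eq_square chr_h_square)

lemma card_dvd_iff: "CARD('p) - Suc 0 dvd n \<longleftrightarrow> 2 * h dvd int n"
  by (metis One_nat_def int_dvd_int_iff q_minus_1(1))

text \<open>An even power of \<omega> is \<open>1\<close> at \<open>-1\<close>, so the reflection
  formula carries no sign.\<close>

lemma gauss_even_reflection: "G (2 * j) * G (- (2 * j)) = wt (2 * j)"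
proof -
  have "chr (2 * j) (- 1) = 1" using chr_multiple[of 2 j "- 1"] by simp
  then show ?thesis by (simp add: gauss_reflection wt_def)
qed

text \<open>Duplication at \<open>2 * j\<close> and at \<open>j\<close>, after inserting
  \<open>G (2 * j) * G (- (2 * j)) = wt (2 * j)\<close>, which cancels at the end. The constant is
  \<open>(-4)^2 * (-4) = -64\<close>.\<close>

lemma gauss_quadruple:
  "G (4 * j) * G (- j) * (G h * G h) = wt j * chr j (- 64) * (G (h + 2 * j) * G (h + j))"
proof -
  have "chr (2 * j) (- 4) = chr j 16" using chr_multiple[of 2 j "- 4"] by simp
  then have c: "chr (2 * j) (- 4) * chr j (- 4) = chr j (- 64)" by (simp flip: chr_mult)
  have "wt (2 * j) * (G (4 * j) * G (- j) * (G h * G h)) =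
      (G (2 * j) * G (- (2 * j))) * (G (4 * j) * G (- j) * (G h * G h))"
    by (simp only: gauss_even_reflection)
  also have "\<dots> = (G (2 * (2 * j)) * G (- (2 * j)) * G h) * (G (2 * j) * G (- j) * G h)"
    by simp
  also have "\<dots> = (wt (2 * j) * chr (2 * j) (- 4) * G (h + 2 * j)) * (wt j * chr j (- 4) * G (h + j))"
    by (simp only: gauss_duplication)
  also have "\<dots> = wt (2 * j) * (wt j * (chr (2 * j) (- 4) * chr j (- 4)) * (G (h + 2 * j) * G (h + j)))"
    by (simp only: mult_ac)
  finally show ?thesis unfolding c by (simp add: wt_nonzero)
qed

text \<open>After interchanging the sums, the sum over \<open>k\<close> selects the points with
  \<open>f x = 1\<close>. This turns an average of Jacobi sums into a sum over roots.\<close>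

lemma chr_orthogonality:
  assumes "\<And>x. f x = 0 \<Longrightarrow> F x = 0"
  shows "(\<Sum>k=0..CARD('p)-2. \<Sum>x\<in>UNIV. F x * chr (int k) (f x)) =
    (of_nat CARD('p) - 1) * (\<Sum>x | f x = 1. F (x :: 'p mod_ring))"
proof -
  have "(\<Sum>k=0..CARD('p)-2. \<Sum>x\<in>UNIV. F x * chr (int k) (f x)) =
      (\<Sum>x\<in>UNIV. F x * (\<Sum>k=0..CARD('p)-2. chr (int k) (f x)))"
    unfolding sum_distrib_left by (rule sum.swap)
  also have "\<dots> = (\<Sum>x\<in>UNIV. if f x = 1 then F x * (of_nat CARD('p) - 1) else 0)"
  proof (intro sum.cong refl)
    fix x
    show "F x * (\<Sum>k=0..CARD('p)-2. chr (int k) (f x)) =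
        (if f x = 1 then F x * (of_nat CARD('p) - 1) else 0)"
      using assms[of x] by (cases "f x = 0") (simp_all add: sum_chr_index)
  qed
  also have "\<dots> = (\<Sum>x | f x = 1. F x * (of_nat CARD('p) - 1))"
    by (simp add: sum.If_cases)
  finally show ?thesis by (simp add: sum_distrib_left mult.commute)
qed

lemma mult_inverse_eq_1_iff: "y \<noteq> 0 \<Longrightarrow> c * inverse y = 1 \<longleftrightarrow> c = (y :: 'p mod_ring)"
  by (simp add: right_inverse_eq flip: divide_inverse)

lemma card_pred_nonzero: "complex_of_nat CARD('p) - 1 \<noteq> 0"
  using q_minus_1(2,3) by simp

end

section \<open>Weights and arguments of the three sums\<close>

locale finite_field_chars_gt_3 = finite_field_chars \<omega> \<zeta> for \<omega> :: "'p::prime_card mod_ring \<Rightarrow> complex" and \<zeta> +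
  assumes card_gt_3: "3 < CARD('p)"
begin

lemma three_nonzero: "(3 :: 'p mod_ring) \<noteq> 0"
  using of_nat_nonzero[of 3] card_gt_3 dvd_imp_le[of "CARD('p)" 3] by fastforce

lemma numeral_nonzero:
  "(6 :: 'p mod_ring) \<noteq> 0" "(9 :: 'p mod_ring) \<noteq> 0" "(16 :: 'p mod_ring) \<noteq> 0"
  "(27 :: 'p mod_ring) \<noteq> 0" "(64 :: 'p mod_ring) \<noteq> 0" "(256 :: 'p mod_ring) \<noteq> 0"
proof -
  have "(2 * 3 :: 'p mod_ring) \<noteq> 0" "(3 * 3 :: 'p mod_ring) \<noteq> 0" "(4 * 4 :: 'p mod_ring) \<noteq> 0"
    "(3 * 3 * 3 :: 'p mod_ring) \<noteq> 0" "(4 * 4 * 4 :: 'p mod_ring) \<noteq> 0" "(4 * 4 * 4 * 4 :: 'p mod_ring) \<noteq> 0"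
    using two_nonzero three_nonzero by (simp_all only: mult_eq_0_iff simp_thms not_False_eq_True)
  then show "(6 :: 'p mod_ring) \<noteq> 0" "(9 :: 'p mod_ring) \<noteq> 0" "(16 :: 'p mod_ring) \<noteq> 0"
  "(27 :: 'p mod_ring) \<noteq> 0" "(64 :: 'p mod_ring) \<noteq> 0" "(256 :: 'p mod_ring) \<noteq> 0"
    by simp_all
qed

text \<open>A common zero needs \<open>4 * k\<close> and one of \<open>k\<close>,
  \<open>3 * k\<close> to be multiples of \<open>p - 1\<close>; in either case \<open>k\<close> is
  one.\<close>

lemma zero_mult_4_1_3: "zero_mult CARD('p) {#4#} {#1, 3#} k = of_bool (2 * h dvd int k)"
proof -
  have "2 * h dvd int k" if "2 * h dvd 4 * int k" "2 * h dvd 3 * int k"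
    using dvd_diff[OF that] by simp
  then show ?thesis
    using card_gt_3 by (subst zero_mult_eq) (auto simp: card_dvd_iff)
qed

lemma zero_mult_6_3_3: "zero_mult CARD('p) {#6#} {#3, 3#} k = of_bool (2 * h dvd 3 * int k)"
proof -
  have "2 * h dvd 6 * int k" if "2 * h dvd 3 * int k"
    using dvd_mult[OF that, of 2] by simp
  then show ?thesis
    using card_gt_3 by (subst zero_mult_eq) (auto simp: card_dvd_iff)
qed

lemma zero_mult_62_314:
  "zero_mult CARD('p) {#6, 2#} {#3, 1, 4#} k = of_bool (2 * h dvd 3 * int k) + of_bool (2 * h dvd 2 * int k)"
proof -
  define d where "d n \<longleftrightarrow> 2 * h dvd n * int k" for n
  have "d 3 \<longrightarrow> d 6" "d 2 \<longrightarrow> d 6" "d 2 \<longrightarrow> d 4"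
    using dvd_mult[of "2 * h" "3 * int k" 2] dvd_mult[of "2 * h" "2 * int k" 3]
      dvd_mult[of "2 * h" "2 * int k" 2] by (simp_all add: d_def)
  moreover have "d 6 \<and> d 4 \<longrightarrow> d 2" "d 3 \<and> d 4 \<longrightarrow> d 1"
    using dvd_diff[of "2 * h" "6 * int k" "4 * int k"] dvd_diff[of "2 * h" "4 * int k" "3 * int k"]
    by (simp_all add: d_def)
  moreover have "d 1 \<longrightarrow> d 3" by (simp add: d_def)
  ultimately have "min (of_bool (d 6) + of_bool (d 2)) (of_bool (d 3) + of_bool (d 1) + of_bool (d 4)) =
      (of_bool (d 3) + of_bool (d 2) :: nat)"
    by (rule min_of_bool_sum)
  moreover have "zero_mult CARD('p) {#6, 2#} {#3, 1, 4#} k =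
      min (of_bool (d 6) + of_bool (d 2)) (of_bool (d 3) + of_bool (d 1) + of_bool (d 4))"
    using card_gt_3 by (subst zero_mult_eq) (auto simp: card_dvd_iff d_def dest: dvd_mult_right)
  ultimately show ?thesis by (simp add: d_def)
qed

text \<open>An odd number of exponents gives the sign \<open>-1\<close>, which turns
  \<open>1 / (1 - p)\<close> into \<open>1 / (p - 1)\<close>.\<close>

lemma BCM_sum_odd:
  assumes "odd (size us + size vs)"
    and wt: "\<And>k. complex_of_nat CARD('p) powi
      (- int (zero_mult CARD('p) us vs 0) + int (zero_mult CARD('p) us vs k)) = w k"
    and N: "(- 1) ^ (\<Sum>\<^sub># vs) *
      inverse ((\<Prod>u\<in>#us. of_nat u ^ u) / (\<Prod>v\<in>#vs. of_nat v ^ v)) * x = (y :: 'p mod_ring)"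
  shows "BCM_sum \<omega> \<zeta> us vs x = inverse (of_nat CARD('p) - 1) * (\<Sum>k=0..CARD('p)-2.
    w k * (\<Prod>u\<in>#us. G (int (u * k))) * (\<Prod>v\<in>#vs. G (- int (v * k))) * chr (int k) y)"
proof -
  have "(- 1) ^ (size us + size vs) / (1 - of_nat CARD('p)) = inverse (complex_of_nat CARD('p) - 1)"
    using assms(1) card_pred_nonzero by (simp add: divide_simps)
  then show ?thesis unfolding BCM_sum_def Let_def N wt by simp
qed

lemma BCM_sum_4_1_3:
  "BCM_sum \<omega> \<zeta> {#4#} {#1, 3#} x = inverse (of_nat CARD('p) - 1) * (\<Sum>k=0..CARD('p)-2.
     inverse (wt (int k)) * (G (4 * int k) * G (- int k) * G (- (3 * int k))) * chr (int k) (27 / 256 * x))"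
proof (subst BCM_sum_odd[where y = "27 / 256 * x"])
  show "complex_of_nat CARD('p) powi (- int (zero_mult CARD('p) {#4#} {#1, 3#} 0) +
      int (zero_mult CARD('p) {#4#} {#1, 3#} k)) = inverse (wt (int k))" for k
    unfolding zero_mult_4_1_3 by (simp add: wt_def power_int_minus)
qed (simp_all add: mult_ac)

lemma BCM_sum_6_3_3:
  "BCM_sum \<omega> \<zeta> {#6#} {#3, 3#} x = inverse (of_nat CARD('p) - 1) * (\<Sum>k=0..CARD('p)-2.
     inverse (wt (3 * int k)) * (G (6 * int k) * G (- (3 * int k)) * G (- (3 * int k))) *
     chr (int k) (1 / 64 * x))"
proof (subst BCM_sum_odd[where y = "1 / 64 * x"])
  show "complex_of_nat CARD('p) powi (- int (zero_mult CARD('p) {#6#} {#3, 3#} 0) +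
      int (zero_mult CARD('p) {#6#} {#3, 3#} k)) = inverse (wt (3 * int k))" for k
    unfolding zero_mult_6_3_3 by (simp add: wt_def power_int_minus)
  \<comment> \<open>The denominator \<open>729\<close> of \<open>N = 6^6 / (3^3 * 3^3) = 64\<close>
    must be invertible modulo \<open>p\<close>.\<close>
  have "(27 * 27 :: 'p mod_ring) \<noteq> 0" using numeral_nonzero by (simp only: mult_eq_0_iff) simp
  then have "(46656 / 729 :: 'p mod_ring) = 64" by (simp add: divide_eq_eq)
  then have "((\<Prod>u\<in>#{#6#}. of_nat u ^ u) / (\<Prod>v\<in>#{#3, 3#}. of_nat v ^ v) :: 'p mod_ring) = 64" by simp
  then show "(- 1) ^ (\<Sum>\<^sub># {#3, 3#}) *
      inverse ((\<Prod>u\<in>#{#6#}. of_nat u ^ u) / (\<Prod>v\<in>#{#3, 3#}. of_nat v ^ v)) * x = 1 / 64 * x"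
    by (simp only: inverse_eq_divide) simp
qed (simp_all add: mult_ac)

lemma BCM_sum_62_314:
  "BCM_sum \<omega> \<zeta> {#6, 2#} {#3, 1, 4#} x = inverse (of_nat CARD('p) - 1) * (\<Sum>k=0..CARD('p)-2.
     inverse (wt (3 * int k) * wt (2 * int k)) *
     (G (6 * int k) * G (2 * int k) * G (- (3 * int k)) * G (- int k) * G (- (4 * int k))) *
     chr (int k) (1 / 27 * x))"
proof (subst BCM_sum_odd[where y = "1 / 27 * x"])
  show "complex_of_nat CARD('p) powi (- int (zero_mult CARD('p) {#6, 2#} {#3, 1, 4#} 0) +
      int (zero_mult CARD('p) {#6, 2#} {#3, 1, 4#} k)) = inverse (wt (3 * int k) * wt (2 * int k))" for k
    unfolding zero_mult_62_314 by (simp add: wt_def power_int_minus power2_eq_square)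
  \<comment> \<open>Here \<open>N = 6^6 * 2^2 / (3^3 * 4^4) = 27\<close>, with denominator
    \<open>6912 = 27 * 256\<close>.\<close>
  have "(27 * 256 :: 'p mod_ring) \<noteq> 0" using numeral_nonzero by (simp only: mult_eq_0_iff) simp
  then have "(186624 / 6912 :: 'p mod_ring) = 27" by (simp add: divide_eq_eq)
  then have "((\<Prod>u\<in>#{#6, 2#}. of_nat u ^ u) / (\<Prod>v\<in>#{#3, 1, 4#}. of_nat v ^ v) :: 'p mod_ring) = 27"
    by simp
  then show "(- 1) ^ (\<Sum>\<^sub># {#3, 1, 4#}) *
      inverse ((\<Prod>u\<in>#{#6, 2#}. of_nat u ^ u) / (\<Prod>v\<in>#{#3, 1, 4#}. of_nat v ^ v)) * x = 1 / 27 * x"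
    by (simp only: inverse_eq_divide) simp
qed (simp_all add: mult_ac)

section \<open>The sums as sums over roots of polynomials\<close>

lemma BCM_sum_4_1_3_cubic:
  assumes "x \<noteq> 0"
  shows "BCM_sum \<omega> \<zeta> {#4#} {#1, 3#} x =
    chr h (- 3 * x) * (\<Sum>a | a \<noteq> 0 \<and> a \<noteq> 1 \<and> 27 * x * (a ^ 3 - a ^ 2) + 4 = 0. chr h a)"
proof -
  define F where "F t = chr h t * chr h (- 1 - t)" for t
  define f where "f t = - (27 / 4 * x) * (t ^ 2 * (- 1 - t))" for t :: "'p mod_ring"
  \<comment> \<open>By \<open>gauss_quadruple\<close> the indices become \<open>h + 2 * j\<close>,
    \<open>h + j\<close> and \<open>- (3 * j)\<close>, whose sum is \<open>2 * h\<close>, so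
    \<open>gauss_jacobi\<close> applies.\<close>
  have summand: "inverse (wt j) * (G (4 * j) * G (- j) * G (- (3 * j))) * chr j (27 / 256 * x) =
      chr h (- 1) * (\<Sum>t\<in>UNIV. F t * chr j (f t))" for j
  proof -
    \<comment> \<open>The correction in \<open>gauss_jacobi\<close> vanishes: if both characters
      were trivial, so would be \<phi>, as \<open>2 * (h + j) - (h + 2 * j) = h\<close>.\<close>
    have "(\<Sum>t\<in>UNIV. chr (h + 2 * j) t) * (\<Sum>t\<in>UNIV. chr (h + j) t) = 0"
    proof -
      have "2 * h dvd h" if "2 * h dvd h + 2 * j" "2 * h dvd h + j"
        using dvd_diff[OF dvd_mult[OF that(2), of 2] that(1)] by simp
      with h_not_dvd show ?thesis by (auto simp: sum_chr)
    qed
    then have J: "G (h + 2 * j) * G (h + j) * G (- (3 * j)) =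
        of_nat CARD('p) * (\<Sum>t\<in>UNIV. chr (h + 2 * j) t * chr (h + j) (- 1 - t))"
      by (subst gauss_jacobi) simp_all
    have "inverse (wt j) * (G (4 * j) * G (- j) * G (- (3 * j))) * (G h * G h) =
        inverse (wt j) * (G (4 * j) * G (- j) * (G h * G h)) * G (- (3 * j))"
      by simp
    also have "\<dots> = chr j (- 64) * (G (h + 2 * j) * G (h + j) * G (- (3 * j)))"
      unfolding gauss_quadruple by (simp add: wt_nonzero)
    finally have "inverse (wt j) * (G (4 * j) * G (- j) * G (- (3 * j))) * chr h (- 1) =
        chr j (- 64) * (\<Sum>t\<in>UNIV. chr (h + 2 * j) t * chr (h + j) (- 1 - t))"
      unfolding J gauss_h_square using q_nonzero by (simp add: mult_ac)
    then have "inverse (wt j) * (G (4 * j) * G (- j) * G (- (3 * j))) * (chr h (- 1) * chr h (- 1)) =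
        chr h (- 1) * (chr j (- 64) * (\<Sum>t\<in>UNIV. chr (h + 2 * j) t * chr (h + j) (- 1 - t)))"
      by (simp add: mult_ac)
    then have "inverse (wt j) * (G (4 * j) * G (- j) * G (- (3 * j))) =
        chr h (- 1) * (chr j (- 64) * (\<Sum>t\<in>UNIV. chr (h + 2 * j) t * chr (h + j) (- 1 - t)))"
      by (simp add: chr_h_square)
    moreover have "chr j (- 64) * (chr (h + 2 * j) t * chr (h + j) (- 1 - t)) * chr j (27 / 256 * x) =
        F t * chr j (f t)" for t
    proof -
      have c: "- (27 / 4 * x) = - 64 * (27 / 256 * x)"
        using two_nonzero numeral_nonzero by (simp add: field_simps)
      have "chr (2 * j) t = chr j (t ^ 2)" using chr_multiple[of 2 j t] by simp
      then show ?thesis unfolding F_def f_def c chr_add by (simp only: chr_mult mult_ac)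
    qed
    ultimately show ?thesis by (simp add: sum_distrib_left sum_distrib_right mult.assoc)
  qed
  have "BCM_sum \<omega> \<zeta> {#4#} {#1, 3#} x =
      chr h (- 1) * (inverse (of_nat CARD('p) - 1) * (\<Sum>k=0..CARD('p)-2. \<Sum>t\<in>UNIV. F t * chr (int k) (f t)))"
    unfolding BCM_sum_4_1_3 summand by (simp add: sum_distrib_left mult.left_commute)
  also have "\<dots> = chr h (- 1) * (\<Sum>t | f t = 1. F t)"
    using assms two_nonzero numeral_nonzero card_pred_nonzero
    by (subst chr_orthogonality) (auto simp: f_def F_def)
  also have "\<dots> = (\<Sum>a | a \<noteq> 0 \<and> a \<noteq> 1 \<and> 27 * x * (a ^ 3 - a ^ 2) + 4 = 0. chr h (- 3 * x) * chr h a)"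
    unfolding sum_distrib_left
  proof (rule sum.reindex_bij_witness[where i = uminus and j = uminus])
    fix t
    assume "t \<in> {t. f t = 1}"
    then have t: "27 * x * (t ^ 2 * (1 + t)) = 4"
      using two_nonzero by (simp add: f_def field_simps)
    have t0: "t \<noteq> 0" "1 + t \<noteq> 0" using t two_nonzero by auto
    then have "- t \<noteq> 1" by (metis add.inverse_inverse add.right_inverse)
    then show "- t \<in> {a. a \<noteq> 0 \<and> a \<noteq> 1 \<and> 27 * x * (a ^ 3 - a ^ 2) + 4 = 0}"
      using t t0 by (simp add: algebra_simps power3_eq_cube power2_eq_square)
    \<comment> \<open>The square factor is chosen to expose the equation for \<open>t\<close>; hence
      \<open>- 1 - t\<close> and \<open>- 3 * x\<close> have the same quadratic character at every
      root.\<close>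
    have "(9 * x * t) ^ 2 * (- 1 - t) = - 3 * x * (27 * x * (t ^ 2 * (1 + t)))"
      by (simp add: algebra_simps power2_eq_square)
    also have "\<dots> = 2 ^ 2 * (- 3 * x)" unfolding t by simp
    finally have "chr h ((9 * x * t) ^ 2 * (- 1 - t)) = chr h (2 ^ 2 * (- 3 * x))" by simp
    then have "chr h (- 1 - t) = chr h (- 3 * x)"
      using t0 assms numeral_nonzero two_nonzero by (simp only: chr_h_mult_square mult_eq_0_iff simp_thms)
    moreover have "chr h (- t) = chr h (- 1) * chr h t" by (simp flip: chr_mult)
    ultimately show "chr h (- 3 * x) * chr h (- t) = chr h (- 1) * F t"
      by (simp add: F_def)
  next
    fix a
    assume "a \<in> {a. a \<noteq> 0 \<and> a \<noteq> 1 \<and> 27 * x * (a ^ 3 - a ^ 2) + 4 = 0}"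
    then have "27 * x * (a ^ 3 - a ^ 2) = - 4" by (simp add: eq_neg_iff_add_eq_0)
    moreover have "4 * f (- a) = - (27 * x * (a ^ 3 - a ^ 2))"
      using two_nonzero by (simp add: f_def field_simps power3_eq_cube power2_eq_square)
    ultimately have "4 * f (- a) = 4 * 1" by simp
    then show "- a \<in> {t. f t = 1}" using two_nonzero by (simp only: mult_cancel_left mem_Collect_eq simp_thms)
  qed simp_all
  finally show ?thesis by (simp add: sum_distrib_left)
qed

text \<open>The indices \<open>4 * j\<close>, \<open>- j\<close>, \<open>- (3 * j)\<close> already
  sum to \<open>0\<close>, so \<open>gauss_jacobi\<close> applies at once. The final
  \<open>- 1\<close> comes from \<open>k = 0\<close>, where the summand is \<open>p - 1\<close> less
  than the general expression.\<close>

lemma BCM_sum_4_1_3_quartic: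
  assumes "x \<noteq> 0"
  shows "BCM_sum \<omega> \<zeta> {#4#} {#1, 3#} x =
    of_nat (card {a. a \<noteq> 0 \<and> a \<noteq> 1 \<and> 256 * (a ^ 4 - a ^ 3) + 27 * x = 0}) - 1"
proof -
  \<comment> \<open>An indicator that removes \<open>0\<close> and \<open>-1\<close>, where the
    inverse in \<open>f\<close> takes its default value \<open>0\<close>.\<close>
  define F where "F t = chr 0 (t * (- 1 - t))" for t
  define f where "f t = (27 / 256 * x) * inverse (t ^ 3 * (- 1 - t))" for t :: "'p mod_ring"
  have summand: "inverse (wt j) * (G (4 * j) * G (- j) * G (- (3 * j))) * chr j (27 / 256 * x) =
      (\<Sum>t\<in>UNIV. F t * chr j (f t)) - (if 2 * h dvd j then of_nat CARD('p) - 1 else 0)" for j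
  proof -
    have J: "G (4 * j) * G (- j) * G (- (3 * j)) =
        of_nat CARD('p) * (\<Sum>t\<in>UNIV. chr (- (3 * j)) t * chr (- j) (- 1 - t)) -
        (\<Sum>t\<in>UNIV. chr (- (3 * j)) t) * (\<Sum>t\<in>UNIV. chr (- j) t)"
      using gauss_jacobi[of "- (3 * j)" "- j" "4 * j"] by (simp add: mult_ac)
    have f: "chr (- (3 * j)) t * chr (- j) (- 1 - t) * chr j (27 / 256 * x) = F t * chr j (f t)" for t
    proof (cases "t * (- 1 - t) = 0")
      case False
      have "chr (- (3 * j)) t = chr j (inverse t ^ 3)"
        using chr_multiple[of 3 j "inverse t"] chr_uminus_inverse[of "3 * j" t] by simp
      then show ?thesis
        using False unfolding F_def f_def chr_uminus_inverse[of j]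
        by (simp add: chr_trivial power_inverse mult_ac flip: chr_mult)
    qed (auto simp: F_def)
    show ?thesis
    proof (cases "2 * h dvd j")
      case True
      have [simp]: "2 * h dvd 3 * j" "2 * h dvd 4 * j" using True by simp_all
      have "(\<Sum>t\<in>UNIV. F t) = of_nat CARD('p) - 2"
      proof -
        have "(\<Sum>t\<in>UNIV. F t) = (\<Sum>t\<in>UNIV - {0, - 1 :: 'p mod_ring}. 1)"
          by (rule sum.mono_neutral_cong_right) (auto simp: F_def chr_trivial eq_diff_eq)
        also have "\<dots> = of_nat CARD('p) - 2"
          using card_gt_3 by (simp add: card_Diff_subset of_nat_diff)
        finally show ?thesis .
      qed
      moreover have "(\<Sum>t\<in>UNIV. F t * chr j (f t)) = (\<Sum>t\<in>UNIV. F t)"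
        using assms numeral_nonzero by (intro sum.cong) (auto simp: F_def f_def chr_trivial[OF True])
      moreover have "chr j (27 / 256 * x) = 1"
        using assms numeral_nonzero by (simp add: chr_trivial[OF True])
      ultimately show ?thesis using True by (simp add: gauss_trivial wt_def)
    next
      case False
      then have "inverse (wt j) * (G (4 * j) * G (- j) * G (- (3 * j))) =
          (\<Sum>t\<in>UNIV. chr (- (3 * j)) t * chr (- j) (- 1 - t))"
        unfolding J using q_nonzero by (simp add: sum_chr wt_def)
      then show ?thesis using False by (simp only: sum_distrib_right f) simp
    qed
  qed
  have "(\<Sum>k=0..CARD('p)-2. if 2 * h dvd int k then complex_of_nat CARD('p) - 1 else 0) =
      (\<Sum>k=0..CARD('p)-2. if k = 0 then of_nat CARD('p) - 1 else 0)"
  proof (intro sum.cong refl)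
    fix k
    assume "k \<in> {0..CARD('p)-2}"
    then have "k < CARD('p) - 1" using card_gt_3 by auto
    then have "CARD('p) - Suc 0 dvd k \<longleftrightarrow> k = 0" by (auto dest: dvd_imp_le)
    then have "2 * h dvd int k \<longleftrightarrow> k = 0" by (simp add: card_dvd_iff)
    then show "(if 2 * h dvd int k then complex_of_nat CARD('p) - 1 else 0) =
        (if k = 0 then of_nat CARD('p) - 1 else 0)" by simp
  qed
  also have "\<dots> = of_nat CARD('p) - 1" by simp
  finally have diag: "(\<Sum>k=0..CARD('p)-2. if 2 * h dvd int k then complex_of_nat CARD('p) - 1 else 0) =
      of_nat CARD('p) - 1" .
  have "BCM_sum \<omega> \<zeta> {#4#} {#1, 3#} x = inverse (of_nat CARD('p) - 1) *
      ((\<Sum>k=0..CARD('p)-2. \<Sum>t\<in>UNIV. F t * chr (int k) (f t)) - (of_nat CARD('p) - 1))"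
    unfolding BCM_sum_4_1_3 summand sum_subtractf diag ..
  also have "(\<Sum>k=0..CARD('p)-2. \<Sum>t\<in>UNIV. F t * chr (int k) (f t)) =
      (of_nat CARD('p) - 1) * (\<Sum>t | f t = 1. F t)"
  proof (rule chr_orthogonality)
    fix t
    assume "f t = 0"
    then have "t ^ 3 * (- 1 - t) = 0"
      using assms numeral_nonzero unfolding f_def
      by (metis divide_eq_0_iff inverse_nonzero_iff_nonzero mult_eq_0_iff)
    then show "F t = 0" unfolding F_def by (simp only: chr_eq_0_iff mult_eq_0_iff power_eq_0_iff) blast
  qed
  also have "inverse c * (c * S - c) = S - 1" if "c \<noteq> 0" for c S :: complex
    using that by (simp add: field_simps)
  note this[OF card_pred_nonzero]
  also have "(\<Sum>t | f t = 1. F t) =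
    (\<Sum>a | a \<noteq> 0 \<and> a \<noteq> 1 \<and> 256 * (a ^ 4 - a ^ 3) + 27 * x = 0. 1)"
  proof (rule sum.reindex_bij_witness[where i = uminus and j = uminus])
    fix t
    assume t: "t \<in> {t. f t = 1}"
    then have t0: "t \<noteq> 0" "- 1 - t \<noteq> 0" by (auto simp: f_def)
    then have "t * (- 1 - t) \<noteq> 0" by simp
    then show "1 = F t" unfolding F_def by (simp add: chr_trivial)
    have y: "t ^ 3 * (- 1 - t) \<noteq> 0" using t0 by simp
    have c: "27 / 256 * x = t ^ 3 * (- 1 - t)"
      using t unfolding f_def mem_Collect_eq mult_inverse_eq_1_iff[OF y] .
    have c': "256 * (t ^ 3 * (- 1 - t)) = 27 * x" unfolding c[symmetric] using numeral_nonzero by simp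
    have q: "(- t) ^ 4 - (- t) ^ 3 = - (t ^ 3 * (- 1 - t))" by (simp add: algebra_simps eval_nat_numeral)
    have "256 * ((- t) ^ 4 - (- t) ^ 3) + 27 * x = 0"
      unfolding q by (simp only: mult_minus_right c' add.left_inverse)
    moreover have "- t \<noteq> 1" using t0 by (metis add.inverse_inverse diff_self)
    ultimately show "- t \<in> {a. a \<noteq> 0 \<and> a \<noteq> 1 \<and> 256 * (a ^ 4 - a ^ 3) + 27 * x = 0}"
      using t0(1) by (simp only: mem_Collect_eq neg_equal_0_iff_equal simp_thms)
  next
    fix a
    assume a: "a \<in> {a. a \<noteq> 0 \<and> a \<noteq> 1 \<and> 256 * (a ^ 4 - a ^ 3) + 27 * x = 0}"
    then have c: "27 * x = 256 * (- (a ^ 4 - a ^ 3))"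
      by (simp only: mem_Collect_eq mult_minus_right eq_neg_iff_add_eq_0 add.commute)
    have "27 / 256 * x = 27 * x / 256" by simp
    also have "\<dots> = - (a ^ 4 - a ^ 3)"
      unfolding c by (rule nonzero_mult_div_cancel_left[OF numeral_nonzero(6)])
    also have "\<dots> = (- a) ^ 3 * (- 1 - (- a))" by (simp add: algebra_simps eval_nat_numeral)
    finally have y: "27 / 256 * x = (- a) ^ 3 * (- 1 - (- a))" .
    have "(- a) ^ 3 * (- 1 - (- a)) \<noteq> 0" using a by simp
    then show "- a \<in> {t. f t = 1}" using y unfolding f_def mem_Collect_eq by (rule iffD2[OF mult_inverse_eq_1_iff])
  qed simp_all
  finally show ?thesis by simp
qed

text \<open>Duplication at \<open>3 * j\<close> and at \<open>- (2 * j)\<close> leaves the indices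
  \<open>h - 2 * j\<close>, \<open>- j\<close> and \<open>h + 3 * j\<close> with sum
  \<open>2 * h\<close>. The roots are those of the cubic in \<open>BCM_sum_4_1_3_cubic\<close> at
  \<open>inverse x\<close>.\<close>

lemma BCM_sum_62_314_cubic:
  assumes "x \<noteq> 0"
  shows "BCM_sum \<omega> \<zeta> {#6, 2#} {#3, 1, 4#} x =
    (\<Sum>a | a \<noteq> 0 \<and> a \<noteq> 1 \<and> 27 * inverse x * (a ^ 3 - a ^ 2) + 4 = 0. chr h a)"
proof -
  define F where "F t = chr h t * chr 0 (- 1 - t)" for t
  define f where "f t = - (4 / 27 * x) * inverse (t ^ 2 * (- 1 - t))" for t :: "'p mod_ring"
  have summand: "inverse (wt (3 * j) * wt (2 * j)) *
      (G (6 * j) * G (2 * j) * G (- (3 * j)) * G (- j) * G (- (4 * j))) * chr j (1 / 27 * x) =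
      chr h (- 1) * (\<Sum>t\<in>UNIV. F t * chr j (f t))" for j
  proof -
    let ?S = "\<Sum>t\<in>UNIV. chr (h - 2 * j) t * chr (- j) (- 1 - t)"
    have "(\<Sum>t\<in>UNIV. chr (h - 2 * j) t) * (\<Sum>t\<in>UNIV. chr (- j) t) = 0"
    proof -
      have "2 * h dvd h" if "2 * h dvd h - 2 * j" "2 * h dvd j"
        using dvd_add[OF dvd_mult[OF that(2), of 2] that(1)] by simp
      with h_not_dvd show ?thesis by (auto simp: sum_chr)
    qed
    then have J: "G (h - 2 * j) * G (- j) * G (h + 3 * j) = of_nat CARD('p) * ?S"
      by (subst gauss_jacobi) simp_all
    have D3: "G (6 * j) * G (- (3 * j)) * G h = wt (3 * j) * chr (3 * j) (- 4) * G (h + 3 * j)"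
      using gauss_duplication[of "3 * j"] by simp
    have D2: "G (- (4 * j)) * G (2 * j) * G h = wt (2 * j) * chr (- (2 * j)) (- 4) * G (h - 2 * j)"
      using gauss_duplication[of "- (2 * j)"] by (simp add: wt_def)
    have c: "chr (3 * j) (- 4) * chr (- (2 * j)) (- 4) = chr j (- 4)"
      by (simp flip: chr_add)
    have "inverse (wt (3 * j) * wt (2 * j)) *
        (G (6 * j) * G (2 * j) * G (- (3 * j)) * G (- j) * G (- (4 * j))) * (G h * G h) =
        inverse (wt (3 * j) * wt (2 * j)) * (G (6 * j) * G (- (3 * j)) * G h) *
        (G (- (4 * j)) * G (2 * j) * G h) * G (- j)"
      \<comment> \<open>The factors are regrouped into the left-hand sides of \<open>D3\<close> and
        \<open>D2\<close>, which use up the two copies of \<open>G h\<close>.\<close>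
      by (simp only: mult_ac)
    also have "\<dots> = inverse (wt (3 * j) * wt (2 * j)) * (wt (3 * j) * wt (2 * j)) *
        (chr (3 * j) (- 4) * chr (- (2 * j)) (- 4)) * (G (h - 2 * j) * G (- j) * G (h + 3 * j))"
      unfolding D2 D3 by (simp only: mult_ac)
    also have "inverse (wt (3 * j) * wt (2 * j)) * (wt (3 * j) * wt (2 * j)) = 1"
      by (rule left_inverse) (simp add: wt_nonzero)
    also have "1 * (chr (3 * j) (- 4) * chr (- (2 * j)) (- 4)) * (G (h - 2 * j) * G (- j) * G (h + 3 * j)) =
        chr j (- 4) * (of_nat CARD('p) * ?S)"
      unfolding c J by simp
    finally have "inverse (wt (3 * j) * wt (2 * j)) *
        (G (6 * j) * G (2 * j) * G (- (3 * j)) * G (- j) * G (- (4 * j))) * chr h (- 1) = chr j (- 4) * ?S"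
      unfolding gauss_h_square using q_nonzero by (simp add: mult_ac)
    then have "inverse (wt (3 * j) * wt (2 * j)) *
        (G (6 * j) * G (2 * j) * G (- (3 * j)) * G (- j) * G (- (4 * j))) * (chr h (- 1) * chr h (- 1)) =
        chr h (- 1) * (chr j (- 4) * ?S)"
      by (simp only: mult_ac)
    then have "inverse (wt (3 * j) * wt (2 * j)) *
        (G (6 * j) * G (2 * j) * G (- (3 * j)) * G (- j) * G (- (4 * j))) =
        chr h (- 1) * (chr j (- 4) * ?S)"
      by (simp add: chr_h_square)
    moreover have "chr j (- 4) * (chr (h - 2 * j) t * chr (- j) (- 1 - t)) * chr j (1 / 27 * x) =
        F t * chr j (f t)" for t
    proof (cases "- 1 - t = 0")
      case False
      have c: "- (4 / 27 * x) = - 4 * (1 / 27 * x)" by simp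
      have "chr (h - 2 * j) t = chr h t * chr (- (2 * j)) t" by (simp flip: chr_add)
      also have "chr (- (2 * j)) t = chr j (inverse (t ^ 2))"
        using chr_multiple[of 2 j t] chr_multiple[of 2 j "inverse t"] chr_uminus_inverse[of "2 * j" t]
        by (simp add: power_inverse)
      finally have "chr (h - 2 * j) t = chr h t * chr j (inverse (t ^ 2))" .
      moreover have "F t = chr h t" using False by (simp add: F_def chr_trivial)
      ultimately show ?thesis
        unfolding f_def c chr_uminus_inverse[of j] inverse_mult_distrib by (simp only: chr_mult mult_ac)
    qed (simp add: F_def)
    ultimately show ?thesis by (simp add: sum_distrib_left sum_distrib_right mult.assoc)
  qed
  have "BCM_sum \<omega> \<zeta> {#6, 2#} {#3, 1, 4#} x =
      chr h (- 1) * (inverse (of_nat CARD('p) - 1) * (\<Sum>k=0..CARD('p)-2. \<Sum>t\<in>UNIV. F t * chr (int k) (f t)))"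
    unfolding BCM_sum_62_314 summand by (simp add: sum_distrib_left mult.left_commute)
  also have "\<dots> = chr h (- 1) * (\<Sum>t | f t = 1. F t)"
    using assms two_nonzero numeral_nonzero card_pred_nonzero
    by (subst chr_orthogonality) (auto simp: f_def F_def)
  also have "\<dots> = (\<Sum>a | a \<noteq> 0 \<and> a \<noteq> 1 \<and> 27 * inverse x * (a ^ 3 - a ^ 2) + 4 = 0. chr h a)"
    unfolding sum_distrib_left
  proof (rule sum.reindex_bij_witness[where i = uminus and j = uminus])
    fix t
    assume t: "t \<in> {t. f t = 1}"
    then have t0: "t \<noteq> 0" "- 1 - t \<noteq> 0" by (auto simp: f_def)
    then have y: "t ^ 2 * (- 1 - t) \<noteq> 0" by simp
    have c: "- (4 / 27 * x) = t ^ 2 * (- 1 - t)"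
      using t unfolding f_def mem_Collect_eq mult_inverse_eq_1_iff[OF y] .
    have "27 * (t ^ 2 * (- 1 - t)) = - (4 * x)" unfolding c[symmetric] using numeral_nonzero by simp
    then have "inverse x * (27 * (t ^ 2 * (- 1 - t))) = inverse x * (- (4 * x))" by simp
    then have e: "inverse x * (27 * (t ^ 2 * (- 1 - t))) = - 4" using assms by simp
    have "27 * inverse x * ((- t) ^ 3 - (- t) ^ 2) = inverse x * (27 * (t ^ 2 * (- 1 - t)))"
      by (simp add: algebra_simps eval_nat_numeral)
    then have "27 * inverse x * ((- t) ^ 3 - (- t) ^ 2) + 4 = 0" by (simp only: e add.left_inverse)
    moreover have "- t \<noteq> 1" using t0 by (metis add.inverse_inverse diff_self)
    ultimately show "- t \<in> {a. a \<noteq> 0 \<and> a \<noteq> 1 \<and> 27 * inverse x * (a ^ 3 - a ^ 2) + 4 = 0}"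
      using t0(1) by (simp only: mem_Collect_eq neg_equal_0_iff_equal simp_thms)
    show "chr h (- t) = chr h (- 1) * F t"
      using t0 by (simp add: F_def chr_trivial flip: chr_mult)
  next
    fix a
    assume a: "a \<in> {a. a \<noteq> 0 \<and> a \<noteq> 1 \<and> 27 * inverse x * (a ^ 3 - a ^ 2) + 4 = 0}"
    then have "27 * inverse x * (a ^ 3 - a ^ 2) = - 4" by (simp add: eq_neg_iff_add_eq_0)
    then have "27 * inverse x * (a ^ 3 - a ^ 2) * x = - 4 * x" by simp
    moreover have "27 * inverse x * c * x = 27 * c" for c using assms by simp
    ultimately have "27 * (a ^ 3 - a ^ 2) = - (4 * x)" by (simp only: mult_minus_left)
    then have c: "- (4 * x) = 27 * (a ^ 3 - a ^ 2)" by (rule sym)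
    have "- (4 / 27 * x) = - (4 * x) / 27" by simp
    also have "\<dots> = a ^ 3 - a ^ 2"
      unfolding c by (rule nonzero_mult_div_cancel_left[OF numeral_nonzero(4)])
    also have "\<dots> = (- a) ^ 2 * (- 1 - (- a))" by (simp add: algebra_simps eval_nat_numeral)
    finally have y: "- (4 / 27 * x) = (- a) ^ 2 * (- 1 - (- a))" .
    have "(- a) ^ 2 * (- 1 - (- a)) \<noteq> 0" using a by simp
    then show "- a \<in> {t. f t = 1}" using y unfolding f_def mem_Collect_eq by (rule iffD2[OF mult_inverse_eq_1_iff])
  qed simp_all
  finally show ?thesis .
qed

text \<open>Equating both evaluations of the \<open>(4; 1, 3)\<close> sum at
  \<open>inverse x\<close> gives \<open>\<phi>(-3x) * (card B - 1)\<close>, with \<open>B\<close>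
  the root set of the quartic. Since \<open>a^2 - a\<close> and \<open>-x/3\<close> have the same
  quadratic character as \<open>-3x\<close>, this is the stated sum.\<close>

lemma BCM_sum_62_314_quartic:
  assumes "x \<noteq> 0"
  shows "BCM_sum \<omega> \<zeta> {#6, 2#} {#3, 1, 4#} x =
    (\<Sum>a | a \<noteq> 0 \<and> a \<noteq> 1 \<and> 256 * x * (a ^ 4 - a ^ 3) + 27 = 0. chr h (a ^ 2 - a)) - chr h (- (x / 3))"
proof -
  let ?B = "{a. a \<noteq> 0 \<and> a \<noteq> 1 \<and> 256 * x * (a ^ 4 - a ^ 3) + 27 = 0}"
  have B: "?B = {a. a \<noteq> 0 \<and> a \<noteq> 1 \<and> 256 * (a ^ 4 - a ^ 3) + 27 * inverse x = 0}"
  proof -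
    have "256 * c + 27 * inverse x = (inverse x * x) * (256 * c) + 27 * inverse x" for c
      using assms by simp
    also have "(inverse x * x) * (256 * c) + 27 * inverse x = inverse x * (256 * x * c + 27)" for c
      by (simp only: distrib_left mult_ac)
    finally have e: "256 * c + 27 * inverse x = inverse x * (256 * x * c + 27)" for c .
    show ?thesis unfolding e using assms by simp
  qed
  have s: "chr h (- 3 * inverse x) = chr h (- 3 * x)"
  proof -
    have "x ^ 2 * (- 3 * inverse x) = - 3 * x * (x * inverse x)"
      by (simp only: power2_eq_square mult_ac)
    then have "x ^ 2 * (- 3 * inverse x) = - 3 * x" using assms by simp
    then show ?thesis using chr_h_mult_square[OF assms, of "- 3 * inverse x"] by metis
  qed
  have "chr h (- 3 * x) * BCM_sum \<omega> \<zeta> {#6, 2#} {#3, 1, 4#} x = of_nat (card ?B) - 1"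
    unfolding BCM_sum_62_314_cubic[OF assms] s[symmetric] B
    using assms by (intro trans[OF sym[OF BCM_sum_4_1_3_cubic] BCM_sum_4_1_3_quartic]) simp_all
  then have "(chr h (- 3 * x) * chr h (- 3 * x)) * BCM_sum \<omega> \<zeta> {#6, 2#} {#3, 1, 4#} x =
      chr h (- 3 * x) * (of_nat (card ?B) - 1)"
    by (simp add: mult.assoc)
  then have "BCM_sum \<omega> \<zeta> {#6, 2#} {#3, 1, 4#} x = chr h (- 3 * x) * (of_nat (card ?B) - 1)"
    using assms three_nonzero by (simp add: chr_h_square)
  moreover have "chr h (a ^ 2 - a) = chr h (- 3 * x)" if "a \<in> ?B" for a
  proof -
    have a: "a \<noteq> 0" "256 * x * (a ^ 4 - a ^ 3) = - 27" using that by (auto simp: eq_neg_iff_add_eq_0)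
    \<comment> \<open>The square factor is chosen so that the quartic equation turns the right side
      into \<open>- 27 * x\<close>, a square times \<open>- 3 * x\<close>.\<close>
    have "(16 * x * a) ^ 2 * (a ^ 2 - a) = x * (256 * x * (a ^ 4 - a ^ 3))"
      by (simp add: algebra_simps eval_nat_numeral)
    also have "\<dots> = 3 ^ 2 * (- 3 * x)" unfolding a(2) by (simp add: mult.commute)
    finally have "chr h ((16 * x * a) ^ 2 * (a ^ 2 - a)) = chr h (3 ^ 2 * (- 3 * x))" by simp
    then show ?thesis
      using a(1) assms numeral_nonzero three_nonzero by (simp only: chr_h_mult_square mult_eq_0_iff simp_thms)
  qed
  moreover have "chr h (- (x / 3)) = chr h (- 3 * x)"
  proof -
    have "3 ^ 2 * (- c) = - 3 * (3 * c)" for c :: "'p mod_ring" by simp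
    then have "3 ^ 2 * (- (x / 3)) = - 3 * (3 * (x / 3))" .
    also have "3 * (x / 3) = x" using three_nonzero by simp
    finally show ?thesis using chr_h_mult_square[OF three_nonzero, of "- (x / 3)"] by metis
  qed
  ultimately show ?thesis by (simp add: algebra_simps)
qed

text \<open>Duplication at \<open>3 * j\<close> leaves two Gauss sums whose characters have product
  \<phi>, so \<open>gauss_jacobi_quadratic\<close> applies. Orthogonality gives
  \<open>x * t^3 = -1\<close>, and \<open>a = t / (t + 1)\<close> carries this to the cubic.\<close>

lemma BCM_sum_6_3_3_cubic:
  assumes "x \<noteq> 0"
  shows "BCM_sum \<omega> \<zeta> {#6#} {#3, 3#} x =
    (\<Sum>a | a \<noteq> 0 \<and> a \<noteq> 1 \<and> (x - 1) * a ^ 3 + 3 * a ^ 2 - 3 * a + 1 = 0. chr h a)"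
proof -
  define F where "F t = chr h t * chr h (t + 1)" for t
  define f where "f t = - x * t ^ 3" for t :: "'p mod_ring"
  have summand: "inverse (wt (3 * j)) * (G (6 * j) * G (- (3 * j)) * G (- (3 * j))) *
      chr j (1 / 64 * x) = (\<Sum>t\<in>UNIV. F t * chr j (f t))" for j
  proof -
    let ?S = "\<Sum>t\<in>UNIV. chr (h + 3 * j) t * chr h (t + 1)"
    have D: "G (6 * j) * G (- (3 * j)) * G h = wt (3 * j) * chr (3 * j) (- 4) * G (h + 3 * j)"
      using gauss_duplication[of "3 * j"] by simp
    have "G h * (inverse (wt (3 * j)) * (G (6 * j) * G (- (3 * j)) * G (- (3 * j)))) =
        inverse (wt (3 * j)) * (G (6 * j) * G (- (3 * j)) * G h) * G (- (3 * j))"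
      by (simp only: mult_ac)
    also have "\<dots> = chr (3 * j) (- 4) * (G (h + 3 * j) * G (- (3 * j)))"
      unfolding D by (simp add: wt_nonzero)
    also have "\<dots> = G h * (chr (3 * j) (- 4) * ?S)"
      unfolding gauss_jacobi_quadratic by simp
    finally have "inverse (wt (3 * j)) * (G (6 * j) * G (- (3 * j)) * G (- (3 * j))) =
        chr (3 * j) (- 4) * ?S"
      using gauss_nonzero by simp
    moreover have "chr (3 * j) (- 4) * (chr (h + 3 * j) t * chr h (t + 1)) * chr j (1 / 64 * x) =
        F t * chr j (f t)" for t
    proof -
      have c: "- x = (- 4) ^ 3 * (1 / 64 * x)" using numeral_nonzero by simp
      have "chr (3 * j) s = chr j (s ^ 3)" for s using chr_multiple[of 3 j s] by simp
      then show ?thesis unfolding F_def f_def c chr_add by (simp only: chr_mult mult_ac)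
    qed
    ultimately show ?thesis by (simp add: sum_distrib_left sum_distrib_right mult.assoc)
  qed
  \<comment> \<open>In this homogeneous form in \<open>a\<close> and \<open>1 - a\<close> the change
    of variable is visible, since \<open>t = a / (1 - a)\<close>.\<close>
  have cubic: "(x - 1) * a ^ 3 + 3 * a ^ 2 - 3 * a + 1 = x * a ^ 3 + (1 - a) ^ 3" for a
    by (simp add: algebra_simps eval_nat_numeral)
  have "BCM_sum \<omega> \<zeta> {#6#} {#3, 3#} x = (\<Sum>t | f t = 1. F t)"
    unfolding BCM_sum_6_3_3 summand using assms card_pred_nonzero
    by (subst chr_orthogonality) (auto simp: f_def F_def)
  \<comment> \<open>The pole \<open>t = -1\<close> of the substitution can be discarded because
    \<open>F\<close> vanishes there.\<close>
  also have "\<dots> = (\<Sum>t | f t = 1 \<and> t + 1 \<noteq> 0. F t)"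
    by (rule sum.mono_neutral_right) (auto simp: F_def)
  also have "\<dots> = (\<Sum>a | a \<noteq> 0 \<and> a \<noteq> 1 \<and> (x - 1) * a ^ 3 + 3 * a ^ 2 - 3 * a + 1 = 0. chr h a)"
  proof (rule sum.reindex_bij_witness[where i = "\<lambda>a. a / (1 - a)" and j = "\<lambda>t. t / (t + 1)"])
    fix t
    assume "t \<in> {t. f t = 1 \<and> t + 1 \<noteq> 0}"
    then have t: "x * t ^ 3 = - 1" "t + 1 \<noteq> 0" by (simp_all add: f_def minus_equation_iff)
    have diff: "1 - t / (t + 1) = 1 / (t + 1)" using t(2) by (simp add: divide_simps)
    show "t / (t + 1) / (1 - t / (t + 1)) = t" unfolding diff using t(2) by simp
    have "(x - 1) * (t / (t + 1)) ^ 3 + 3 * (t / (t + 1)) ^ 2 - 3 * (t / (t + 1)) + 1 =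
        x * (t / (t + 1)) ^ 3 + (1 - t / (t + 1)) ^ 3"
      by (rule cubic)
    also have "\<dots> = (x * t ^ 3 + 1) / (t + 1) ^ 3"
      unfolding diff by (simp add: power_divide add_divide_distrib)
    also have "\<dots> = 0" unfolding t(1) by simp
    finally have "(x - 1) * (t / (t + 1)) ^ 3 + 3 * (t / (t + 1)) ^ 2 - 3 * (t / (t + 1)) + 1 = 0" .
    moreover have "t / (t + 1) \<noteq> 0" using t by auto
    moreover have "t / (t + 1) \<noteq> 1" using t(2) diff by auto
    ultimately show "t / (t + 1) \<in> {a. a \<noteq> 0 \<and> a \<noteq> 1 \<and> (x - 1) * a ^ 3 + 3 * a ^ 2 - 3 * a + 1 = 0}"
      by blast
    \<comment> \<open>Thus \<open>a\<close> and \<open>t * (t + 1)\<close> differ by a nonzero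
      square.\<close>
    have "(t + 1) ^ 2 * (t / (t + 1)) = t * (t + 1)" using t(2) by (simp add: power2_eq_square)
    then show "chr h (t / (t + 1)) = F t"
      using chr_h_mult_square[OF t(2), of "t / (t + 1)"] by (simp add: F_def chr_mult)
  next
    fix a
    assume "a \<in> {a. a \<noteq> 0 \<and> a \<noteq> 1 \<and> (x - 1) * a ^ 3 + 3 * a ^ 2 - 3 * a + 1 = 0}"
    then have a: "1 - a \<noteq> 0" "x * a ^ 3 + (1 - a) ^ 3 = 0" unfolding cubic by auto
    have sum: "a / (1 - a) + 1 = 1 / (1 - a)" using a(1) by (simp add: divide_simps)
    show "a / (1 - a) / (a / (1 - a) + 1) = a" unfolding sum using a(1) by simp
    have "f (a / (1 - a)) = - (x * a ^ 3) / (1 - a) ^ 3" by (simp add: f_def power_divide)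
    also have "- (x * a ^ 3) = (1 - a) ^ 3" using a(2) by (simp only: neg_eq_iff_add_eq_0)
    finally have "f (a / (1 - a)) = 1" using a(1) by simp
    then show "a / (1 - a) \<in> {t. f t = 1 \<and> t + 1 \<noteq> 0}" using a(1) by (simp add: sum)
  qed
  finally show ?thesis .
qed

end

theorem theorem1p5:
  fixes \<omega> :: "'p::prime_card mod_ring \<Rightarrow> complex"
    and \<zeta> :: complex
    and x :: "'p mod_ring"
  assumes "CARD('p) > 3"
    and "generates_chars \<omega>"
    and "primitive_root_of_unity CARD('p) \<zeta>"
    and "x \<noteq> 0"
  shows
    "hyp_H \<omega> \<zeta> {#1/2, 1/4, 3/4#} {#1, 1/3, 2/3#} x =
       quad_char (- 3 * x) *
       (\<Sum>a\<in>{a. a \<noteq> 0 \<and> a \<noteq> 1 \<and> 27 * x * (a ^ 3 - a ^ 2) + 4 = 0}. quad_char a) \<and>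
     hyp_H \<omega> \<zeta> {#1/2, 1/6, 5/6#} {#1, 1/4, 3/4#} x =
       (\<Sum>a\<in>{a. a \<noteq> 0 \<and> a \<noteq> 1 \<and> 256 * x * (a ^ 4 - a ^ 3) + 27 = 0}. quad_char (a ^ 2 - a)) -
       quad_char (- (x / 3)) \<and>
     hyp_H \<omega> \<zeta> {#1/2, 1/6, 5/6#} {#1, 1/3, 2/3#} x =
       (\<Sum>a\<in>{a. a \<noteq> 0 \<and> a \<noteq> 1 \<and> (x - 1) * a ^ 3 + 3 * a ^ 2 - 3 * a + 1 = 0}. quad_char a)"
proof -
  interpret finite_field_chars_gt_3 \<omega> \<zeta>
    by unfold_locales (use assms in auto)
  show ?thesis
    unfolding cyc_data_values[THEN hyp_H_eqI] quad_char_eq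
    by (intro conjI BCM_sum_4_1_3_cubic BCM_sum_62_314_quartic BCM_sum_6_3_3_cubic assms(4))
qed

end
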